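(* Let $(\phi_t)$ and $(\tilde\phi_t)$ be non-elliptic semigroups in $\mathbb D$ with Koenigs functions $h$ and $\tilde h$, Denjoy-Wolff points $\tau,\tilde\tau\in\partial\mathbb D$, and orthogonal speeds $v^o(t)$ and $\tilde v^o(t)$, respectively. Suppose that $h(\mathbb D)\subset\tilde h(\mathbb D)$. Then $$\limsup_{t\to+\infty}\,[v^o(t)-\tilde v^o(t)]>-\infty,$$ or, equivalently, $$\liminf_{t\to+\infty}\frac{|\phi_t(0)-\tau|}{|\tilde\phi_t(0)-\tilde\tau|}<+\infty.$$
   Context: Let $\mathbb D=\{z\in\mathbb C:|z|<1\}$. A (continuous) semigroup in $\mathbb D$ is a family $(\phi_t)_{t\ge0}$ of holomorphic self-maps of $\mathbb D$ with $\phi_0=\mathrm{id}$, $\phi_{s+t}=\phi_s\circ\phi_t$, and $t\mapsto\phi_t$ continuous for uniform convergence on compacta. It is non-elliptic if it has no fixed points in $\mathbb D$ (no $z\in\mathbb D$ with $\phi_t(z)=z$ for all $t\geq 0$). In that case there is a unique $\tau\in\partial\mathbb D$, the Denjoy-Wolff point, with $\lim_{t\to+\infty}\phi_t(z)=\tau$ for all $z\in\mathbb D$. A Koenigs function of a non-elliptic semigroup $(\phi_t)$ is a univalent function $h:\mathbb D\to\mathbb C$ such that (i) $h(\phi_t(z))=h(z)+it$ for all $z\in\mathbb D$, $t\ge0$, and (ii) $\bigcup_{t\ge0}(h(\mathbb D)-it)$ is a vertical strip, a vertical half-plane, or $\mathbb C$; it exists and is essentially unique (up to an additive constant). Let $k_{\mathbb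 D}$ be the hyperbolic distance of $\mathbb D$, normalized by $k_{\mathbb D}(0,z)=\frac12\log\frac{1+|z|}{1-|z|}$. For $z\in\mathbb D$ let $\pi(z)$ be the unique point of the geodesic $(-1,1)\tau$ that is closest to $z$ with respect to $k_{\mathbb D}$. The orthogonal speed of $(\phi_t)$ is $v^o(t):=k_{\mathbb D}(0,\pi(\phi_t(0)))$, $t\ge0$. *)

theory Defs
  imports "HOL-Complex_Analysis.Complex_Analysis"
begin

abbreviation unit_disc :: "complex set" (\<open>\<D>\<close>) where
  "\<D> \<equiv> ball 0 1"

text \<open>
  The semigroup is indexed by all of \<^typ>\<open>real\<close>, and its maps act on all of \<^typ>\<open>complex\<close>;
  only the values at times \<open>t \<ge> 0\<close> and points of \<open>\<D>\<close> are meaningful. The last clause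
  is continuity of the family in time on \<open>[0,\<infinity>)\<close> for uniform convergence on compacta.
\<close>

definition semigroup_in_disc :: "(real \<Rightarrow> complex \<Rightarrow> complex) \<Rightarrow> bool" where
  "semigroup_in_disc \<phi> \<longleftrightarrow>
     (\<forall>t\<ge>0. \<phi> t holomorphic_on \<D> \<and> \<phi> t ` \<D> \<subseteq> \<D>) \<and>
     (\<forall>z\<in>\<D>. \<phi> 0 z = z) \<and>
     (\<forall>s\<ge>0. \<forall>t\<ge>0. \<forall>z\<in>\<D>. \<phi> (s + t) z = \<phi> s (\<phi> t z)) \<and>
     (\<forall>K. compact K \<and> K \<subseteq> \<D> \<longrightarrow>
        (\<forall>t\<ge>0. uniform_limit K \<phi> (\<phi> t) (at t within {0..})))"

definition non_elliptic :: "(real \<Rightarrow> complex \<Rightarrow> complex) \<Rightarrow> bool" where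
  "non_elliptic \<phi> \<longleftrightarrow> \<not> (\<exists>z\<in>\<D>. \<forall>t\<ge>0. \<phi> t z = z)"

definition Denjoy_Wolff_point :: "(real \<Rightarrow> complex \<Rightarrow> complex) \<Rightarrow> complex \<Rightarrow> bool" where
  "Denjoy_Wolff_point \<phi> \<tau> \<longleftrightarrow>
     \<tau> \<in> sphere 0 1 \<and> (\<forall>z\<in>\<D>. ((\<lambda>t. \<phi> t z) \<longlongrightarrow> \<tau>) at_top)"

definition vertical_strip :: "complex set \<Rightarrow> bool" where
  "vertical_strip S \<longleftrightarrow> (\<exists>a b. a < b \<and> S = {w. a < Re w \<and> Re w < b})"

definition vertical_half_plane :: "complex set \<Rightarrow> bool" where
  "vertical_half_plane S \<longleftrightarrow> (\<exists>a. S = {w. a < Re w} \<or> S = {w. Re w < a})"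

definition Koenigs_function ::
  "(real \<Rightarrow> complex \<Rightarrow> complex) \<Rightarrow> (complex \<Rightarrow> complex) \<Rightarrow> bool" where
  "Koenigs_function \<phi> h \<longleftrightarrow>
     h holomorphic_on \<D> \<and> inj_on h \<D> \<and>
     (\<forall>t\<ge>0. \<forall>z\<in>\<D>. h (\<phi> t z) = h z + \<i> * of_real t) \<and>
     (let \<Omega> = (\<Union>t\<in>{0..}. (\<lambda>w. w - \<i> * of_real t) ` h ` \<D>)
      in vertical_strip \<Omega> \<or> vertical_half_plane \<Omega> \<or> \<Omega> = UNIV)"

definition hyperbolic_dist :: "complex \<Rightarrow> complex \<Rightarrow> real" where
  "hyperbolic_dist z w =
     1 / 2 * ln ((1 + norm (Moebius_function 0 z w)) / (1 - norm (Moebius_function 0 z w)))"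

lemma hyperbolic_dist_0: "hyperbolic_dist 0 z = 1 / 2 * ln ((1 + norm z) / (1 - norm z))"
  by (simp add: hyperbolic_dist_def Moebius_function_simple)

definition diameter_geodesic :: "complex \<Rightarrow> complex set" where
  "diameter_geodesic \<tau> = (\<lambda>r. of_real r * \<tau>) ` {-1<..<1}"

definition geodesic_projection :: "complex \<Rightarrow> complex \<Rightarrow> complex" where
  "geodesic_projection \<tau> z =
     (THE w. w \<in> diameter_geodesic \<tau> \<and>
        (\<forall>u\<in>diameter_geodesic \<tau>. hyperbolic_dist z w \<le> hyperbolic_dist z u))"

text \<open>The parameter \<open>\<tau>\<close> is meant to be the Denjoy--Wolff point of \<open>\<phi>\<close>.\<close>

definition orthogonal_speed :: "(real \<Rightarrow> complex \<Rightarrow> complex) \<Rightarrow> complex \<Rightarrow> real \<Rightarrow> real" where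
  "orthogonal_speed \<phi> \<tau> t = hyperbolic_dist 0 (geodesic_projection \<tau> (\<phi> t 0))"

end

theory Submission
  imports Defs
begin

text \<open>
  Since \<open>h(\<D>) \<subseteq> h'(\<D>)\<close>, the map \<open>g = h'\<^sup>-\<^sup>1 \<circ> h\<close> is a holomorphic self-map of the disc with
  \<open>g \<circ> \<phi>\<^sub>t = \<phi>'\<^sub>t \<circ> g\<close>. It carries the orbit of \<open>0\<close> under \<open>\<phi>\<close> to the orbit of \<open>g 0\<close> under \<open>\<phi>'\<close>,
  and by Harnack's inequality the latter approaches \<open>\<tau>'\<close> as fast as the orbit of \<open>0\<close> under \<open>\<phi>'\<close>,
  up to a constant factor. The guiding principle is that a holomorphic self-map can only increase
  harmonic measure, and that the harmonic measure, seen from the origin, of a path ending at a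
  boundary point is comparable to the largest distance of the path from that point.

  Harmonic measure is replaced by two explicit estimates. If a tail of the second orbit lies within
  \<open>\<epsilon>\<close> of \<open>\<tau>'\<close>, there is a positive harmonic function that is at least \<open>1\<close> near that tail and
  \<open>O(\<epsilon>)\<close> at \<open>g 0\<close> (\<open>boundary_peak\<close>); composing it with \<open>g\<close> gives a positive harmonic function \<open>U\<close>
  that is at least \<open>1\<close> on the corresponding tail of the first orbit and has \<open>U 0 = O(\<epsilon>)\<close>. Conversely, a
  positive harmonic function that is at least \<open>1\<close> on a path ending at \<open>\<tau>\<close> satisfies
  \<open>\<bar>x - \<tau>\<bar> \<le> 80 \<pi> U 0\<close> for the starting point \<open>x\<close> of the path (\<open>path_to_boundary_point_bound\<close>). This
  is the heart of the proof and holds however tangentially the path approaches the circle. It is an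
  argument in the style of Hall's lemma: wherever \<open>U \<ge> 1\<close>, some arc centred at the radial projection
  of the point carries boundary mass of \<open>U\<close> proportional to its length (\<open>heavy_arc\<close>); the arcs
  belonging to the points of the path cover an arc of length about \<open>\<bar>x - \<tau>\<bar>\<close>, and a Vitali covering
  argument (\<open>length_le_integral_of_heavy_intervals\<close>) bounds that length by the total mass, which is a
  multiple of \<open>U 0\<close>.

  Together these give \<open>\<bar>\<phi>\<^sub>s(0) - \<tau>\<bar> \<le> C sup\<^bsub>r \<ge> s\<^esub> \<bar>\<phi>'\<^sub>r(0) - \<tau>'\<bar>\<close>. Beyond any time there is an \<open>s\<close> at which
  the supremum is attained up to a factor \<open>2\<close>, so that \<open>\<bar>\<phi>\<^sub>s(0) - \<tau>\<bar> \<le> 2 C \<bar>\<phi>'\<^sub>s(0) - \<tau>'\<bar>\<close> at arbitrarily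
  large times (\<open>frequently_rate_le\<close>); this is the bound on the limit inferior. The orthogonal speed at an
  orbit point \<open>z\<close> is \<open>\<bar>log (\<bar>z + \<tau>\<bar> / \<bar>z - \<tau>\<bar>)\<bar> / 2\<close>, which differs from \<open>- log \<bar>z - \<tau>\<bar> / 2\<close> by a bounded
  amount near \<open>\<tau>\<close>, and the bound on the limit superior follows from the same times.
\<close>

section \<open>The Poisson integral formula\<close>

lemma Poisson_kernel_identity:
  fixes u z :: complex
  assumes "norm z < norm u"
  shows "u * (1 / (u - z) + cnj z / ((of_real (norm u))\<^sup>2 - cnj z * u))
           = of_real (((norm u)\<^sup>2 - (norm z)\<^sup>2) / (norm (u - z))\<^sup>2)"
proof -
  have ne: "u \<noteq> 0" "u - z \<noteq> 0" "cnj u - cnj z \<noteq> 0"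
    using assms by (auto simp flip: complex_cnj_diff)
  have sq: "(of_real (norm w))\<^sup>2 = w * cnj w" for w :: complex
    by (simp only: complex_norm_square flip: of_real_power)
  have "u * (1 / (u - z) + cnj z / ((of_real (norm u))\<^sup>2 - cnj z * u))
          = u / (u - z) + (u * cnj z) / (u * (cnj u - cnj z))"
    by (simp add: sq ring_distribs mult.commute)
  also have "\<dots> = u / (u - z) + cnj z / (cnj u - cnj z)"
    using ne by simp
  also have "\<dots> = (u * cnj u - z * cnj z) / ((u - z) * (cnj u - cnj z))"
    using ne by (simp add: divide_simps) (simp add: algebra_simps)
  also have "\<dots> = of_real (((norm u)\<^sup>2 - (norm z)\<^sup>2) / (norm (u - z))\<^sup>2)"
    by (simp add: sq)
  finally show ?thesis .
qed

text \<open>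
  Cauchy's formula is applied at \<open>z\<close>, and Cauchy's theorem at the point \<open>R\<^sup>2 / cnj z\<close> obtained by
  reflecting \<open>z\<close> in the circle, which lies outside the disc. On the circle the two Cauchy kernels
  add up to the real Poisson kernel.
\<close>

theorem Poisson_integral_holomorphic:
  fixes F :: "complex \<Rightarrow> complex"
  assumes holF: "F holomorphic_on cball 0 R" and z: "norm z < R"
  shows "((\<lambda>\<theta>. of_real ((R\<^sup>2 - (norm z)\<^sup>2) / (norm (of_real R * cis \<theta> - z))\<^sup>2) * F (of_real R * cis \<theta>))
           has_integral 2 * pi * F z) {0..2*pi}"
proof -
  have R: "R > 0"
    using z norm_ge_zero le_less_trans by blast
  define k where "k = (\<lambda>u. F u / (u - z) + cnj z * F u / ((of_real R)\<^sup>2 - cnj z * u))"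
  have ne: "(of_real R)\<^sup>2 - cnj z * u \<noteq> 0" if "u \<in> cball 0 R" for u
  proof
    assume "(of_real R)\<^sup>2 - cnj z * u = 0"
    then have "norm (of_real R ^ 2 :: complex) = norm (cnj z * u)" by simp
    then have "R\<^sup>2 = norm z * norm u"
      by (simp add: norm_mult norm_power)
    also have "\<dots> \<le> norm z * R"
      using that by (intro mult_left_mono) auto
    also have "\<dots> < R * R"
      using z R by simp
    finally show False by (simp add: power2_eq_square)
  qed
  have "((\<lambda>u. F u / (u - z)) has_contour_integral (2 * of_real pi * \<i> * F z)) (circlepath 0 R)"
    using Cauchy_integral_circlepath_simple[OF holF, of z] z by simp
  moreover have "((\<lambda>u. cnj z * F u / ((of_real R)\<^sup>2 - cnj z * u)) has_contour_integral 0) (circlepath 0 R)"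
  proof (rule Cauchy_theorem_convex_simple[where S = "cball 0 R"])
    show "(\<lambda>u. cnj z * F u / ((of_real R)\<^sup>2 - cnj z * u)) holomorphic_on cball 0 R"
      using ne by (intro holomorphic_intros holF) auto
  qed (use R in auto)
  ultimately have "(k has_contour_integral (2 * of_real pi * \<i> * F z)) (circlepath 0 R)"
    unfolding k_def using has_contour_integral_add by fastforce
  then have "((\<lambda>\<theta>. k (of_real R * cis \<theta>) * of_real R * \<i> * cis \<theta>) has_integral 2 * of_real pi * \<i> * F z) {0..2*pi}"
    unfolding circlepath_def by (subst (asm) has_contour_integral_part_circlepath_iff) (auto simp: mult_ac)
  from has_integral_mult_right[OF this, of "-\<i>"]
  have "((\<lambda>\<theta>. -\<i> * (k (of_real R * cis \<theta>) * of_real R * \<i> * cis \<theta>)) has_integral 2 * pi * F z) {0..2*pi}"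
    by (simp add: algebra_simps)
  moreover have "-\<i> * (k (of_real R * cis \<theta>) * of_real R * \<i> * cis \<theta>)
      = of_real ((R\<^sup>2 - (norm z)\<^sup>2) / (norm (of_real R * cis \<theta> - z))\<^sup>2) * F (of_real R * cis \<theta>)" for \<theta>
  proof -
    let ?u = "of_real R * cis \<theta>"
    have nu: "norm ?u = R" using R by (simp add: norm_mult)
    have "-\<i> * (k ?u * of_real R * \<i> * cis \<theta>) = k ?u * ?u"
      by (simp add: algebra_simps)
    also have "\<dots> = (?u * (1 / (?u - z) + cnj z / ((of_real (norm ?u))\<^sup>2 - cnj z * ?u))) * F ?u"
      unfolding nu k_def by (simp add: algebra_simps add_divide_distrib)
    also have "\<dots> = of_real ((R\<^sup>2 - (norm z)\<^sup>2) / (norm (?u - z))\<^sup>2) * F ?u"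
      using Poisson_kernel_identity[of z ?u, unfolded nu, OF z] by (simp only: nu)
    finally show ?thesis .
  qed
  ultimately show ?thesis
    by (simp only:)
qed

lemma Poisson_denominator:
  "(norm (of_real R * cis \<theta> - of_real \<rho>))\<^sup>2 = R\<^sup>2 - 2 * R * \<rho> * cos \<theta> + \<rho>\<^sup>2"
proof -
  have "(norm (of_real R * cis \<theta> - of_real \<rho>))\<^sup>2 = (R * cos \<theta> - \<rho>)\<^sup>2 + (R * sin \<theta>)\<^sup>2"
    by (simp add: cmod_power2)
  also have "\<dots> = R\<^sup>2 * ((sin \<theta>)\<^sup>2 + (cos \<theta>)\<^sup>2) - 2 * R * \<rho> * cos \<theta> + \<rho>\<^sup>2"
    by (simp only: power2_diff power_mult_distrib) algebra
  finally show ?thesis by simp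
qed

definition Poisson_kernel :: "real \<Rightarrow> real \<Rightarrow> real \<Rightarrow> real" where
  "Poisson_kernel R \<rho> \<theta> = (R\<^sup>2 - \<rho>\<^sup>2) / (R\<^sup>2 - 2 * R * \<rho> * cos \<theta> + \<rho>\<^sup>2)"

text \<open>
  The polar form, with the angle measured from the ray through the evaluation point, so that the
  kernel becomes even and decreasing in \<open>\<bar>\<theta>\<bar>\<close>.
\<close>

corollary Poisson_integral:
  fixes F :: "complex \<Rightarrow> complex"
  assumes holF: "F holomorphic_on cball 0 R" and \<rho>: "0 \<le> \<rho>" "\<rho> < R"
  shows "((\<lambda>\<theta>. Poisson_kernel R \<rho> \<theta> * Re (F (of_real R * cis (a + \<theta>))))
           has_integral 2 * pi * Re (F (of_real \<rho> * cis a))) {-pi..pi}"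
proof -
  \<comment> \<open>The rotation puts the evaluation point on the negative axis, so that \<open>{0..2*pi}\<close> is centred at its angle.\<close>
  define G where "G = (\<lambda>z. F (cis (a - pi) * z))"
  have "G holomorphic_on cball 0 R"
    unfolding G_def
    by (rule holomorphic_on_compose_gen[OF _ holF, unfolded o_def])
       (auto intro!: holomorphic_intros simp: norm_mult)
  then have "((\<lambda>\<theta>. of_real ((R\<^sup>2 - (norm (- of_real \<rho> :: complex))\<^sup>2) / (norm (of_real R * cis \<theta> - (- of_real \<rho>)))\<^sup>2)
                  * G (of_real R * cis \<theta>))
           has_integral 2 * pi * G (- of_real \<rho>)) (cbox 0 (2*pi))"
    using Poisson_integral_holomorphic[of G R "- of_real \<rho>"] \<rho> by simp
  from has_integral_affinity'[OF this, of 1 pi]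
  have "((\<lambda>\<theta>. of_real ((R\<^sup>2 - (norm (- of_real \<rho> :: complex))\<^sup>2) / (norm (of_real R * cis (\<theta> + pi) - (- of_real \<rho>)))\<^sup>2)
                  * G (of_real R * cis (\<theta> + pi)))
           has_integral 2 * pi * G (- of_real \<rho>)) {-pi..pi}"
    by simp
  from has_integral_Re[OF this]
  have "((\<lambda>\<theta>. Re (of_real ((R\<^sup>2 - (norm (- of_real \<rho> :: complex))\<^sup>2) / (norm (of_real R * cis (\<theta> + pi) - (- of_real \<rho>)))\<^sup>2)
                  * G (of_real R * cis (\<theta> + pi))))
           has_integral Re (2 * pi * G (- of_real \<rho>))) {-pi..pi}"
    .
  moreover have "Re (2 * pi * G (- of_real \<rho>)) = 2 * pi * Re (F (of_real \<rho> * cis a))"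
    by (simp add: G_def mult.commute flip: cis_divide)
  moreover have "Re (of_real ((R\<^sup>2 - (norm (- of_real \<rho> :: complex))\<^sup>2) / (norm (of_real R * cis (\<theta> + pi) - (- of_real \<rho>)))\<^sup>2)
                  * G (of_real R * cis (\<theta> + pi)))
        = Poisson_kernel R \<rho> \<theta> * Re (F (of_real R * cis (a + \<theta>)))" for \<theta>
  proof -
    have "cis (a - pi) * (of_real R * cis (\<theta> + pi)) = of_real R * cis (a + \<theta>)"
      by (simp add: mult.left_commute cis_mult)
    moreover have "(norm (of_real R * cis (\<theta> + pi) - (- of_real \<rho>)))\<^sup>2 = R\<^sup>2 - 2 * R * \<rho> * cos \<theta> + \<rho>\<^sup>2"
      using Poisson_denominator[of R "\<theta> + pi" "-\<rho>"] by simp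
    ultimately show ?thesis
      unfolding Poisson_kernel_def G_def by (simp only:) simp
  qed
  ultimately show ?thesis
    by (simp only:)
qed

section \<open>Two estimates for integrals on the line\<close>

lemma integral_symmetric_interval:
  fixes f :: "real \<Rightarrow> real"
  assumes "0 \<le> h" and cont: "continuous_on {-h..h} f"
  shows "integral {-h..h} f = integral {0..h} (\<lambda>x. f x + f (- x))"
proof -
  have int: "f integrable_on {-h..h}"
    using cont by (rule integrable_continuous_real)
  have "continuous_on {0..h} (\<lambda>x. f (- x))"
    by (rule continuous_on_compose2[OF cont]) (auto intro!: continuous_intros)
  then have 1: "(\<lambda>x. f (- x)) integrable_on {0..h}"
    by (rule integrable_continuous_real)
  have 2: "f integrable_on {0..h}"
    using int by (rule integrable_on_subinterval) auto
  have "integral {-h..h} f = integral {-h..0} f + integral {0..h} f"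
    using Henstock_Kurzweil_Integration.integral_combine[where a = "-h" and c = 0 and b = h and f = f] int assms by simp
  also have "integral {-h..0} f = integral {0..h} (\<lambda>x. f (- x))"
    using Henstock_Kurzweil_Integration.integral_reflect_real[where a = "-h" and b = 0 and f = f] by simp
  finally show ?thesis
    using integral_add[OF 2 1] by simp
qed

text \<open>
  An even decreasing weight is a superposition of indicators of centred intervals, so a function
  whose integral over every centred interval is nonpositive has nonpositive weighted integral.
  Superposition is replaced by integration by parts: with \<open>S h\<close> the integral of \<open>f\<close> over \<open>{-h..h}\<close>, the
  function \<open>\<Xi> h = (integral of p f over {-h..h}) - p h S h\<close> has derivative \<open>- p' h S h \<le> 0\<close>.
\<close>

lemma integral_even_decreasing_mult_nonpos:
  fixes f p p' :: "real \<Rightarrow> real"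
  assumes b: "0 < b" and cont: "continuous_on {-b..b} f"
    and deriv: "\<And>x. (p has_real_derivative p' x) (at x)"
    and even: "\<And>x. p (- x) = p x"
    and decr: "\<And>x. x \<in> {0..b} \<Longrightarrow> p' x \<le> 0"
    and nonneg: "0 \<le> p b"
    and centred: "\<And>h. 0 < h \<Longrightarrow> h \<le> b \<Longrightarrow> integral {-h..h} f \<le> 0"
  shows "integral {-b..b} (\<lambda>x. p x * f x) \<le> 0"
proof -
  have contp: "continuous_on A p" for A
    using deriv by (meson DERIV_isCont continuous_at_imp_continuous_on)
  define s where "s = (\<lambda>x. f x + f (- x))"
  define S where "S = (\<lambda>h. integral {0..h} s)"
  define \<Xi> where "\<Xi> = (\<lambda>h. integral {0..h} (\<lambda>x. p x * s x) - p h * S h)"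
  have conts: "continuous_on {0..b} s"
    unfolding s_def
    by (intro continuous_intros continuous_on_subset[OF cont] continuous_on_compose2[OF cont]) auto
  have S: "S h \<le> 0" if "0 \<le> h" "h \<le> b" for h
  proof (cases "h = 0")
    case False
    then have "integral {-h..h} f \<le> 0"
      using centred that by simp
    moreover have "continuous_on {-h..h} f"
      using that by (intro continuous_on_subset[OF cont]) auto
    ultimately show ?thesis
      using that integral_symmetric_interval[of h f] by (simp add: S_def s_def)
  qed (simp add: S_def)
  have d\<Xi>: "(\<Xi> has_real_derivative - (p' h * S h)) (at h within {0..b})" if h: "h \<in> {0..b}" for h
  proof -
    have "((\<lambda>h. integral {0..h} (\<lambda>x. p x * s x)) has_real_derivative p h * s h) (at h within {0..b})"
      using h by (intro integral_has_real_derivative continuous_intros contp conts)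
    moreover have "(S has_real_derivative s h) (at h within {0..b})"
      unfolding S_def using h by (intro integral_has_real_derivative conts)
    moreover have "(p has_real_derivative p' h) (at h within {0..b})"
      using deriv DERIV_subset by blast
    ultimately show ?thesis
      unfolding \<Xi>_def by (auto intro!: derivative_eq_intros)
  qed
  have "\<Xi> b \<le> \<Xi> 0"
  proof (rule DERIV_nonpos_imp_decreasing_open[of 0 b \<Xi>])
    show "\<exists>y. (\<Xi> has_real_derivative y) (at x) \<and> y \<le> 0" if "0 < x" "x < b" for x
    proof -
      have "- (p' x * S x) \<le> 0"
        using decr[of x] S[of x] that by (simp add: mult_nonpos_nonpos)
      then show ?thesis
        using d\<Xi>[of x] that by (auto simp: at_within_Icc_at)
    qed
    show "continuous_on {0..b} \<Xi>"
      by (rule DERIV_continuous_on[OF d\<Xi>])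
  qed (use b in linarith)
  moreover have "\<Xi> 0 = 0"
    by (simp add: \<Xi>_def S_def)
  moreover have "p b * S b \<le> 0"
    using nonneg S[of b] b by (simp add: mult_nonneg_nonpos)
  ultimately have "integral {0..b} (\<lambda>x. p x * s x) \<le> 0"
    by (auto simp: \<Xi>_def)
  moreover have "integral {-b..b} (\<lambda>x. p x * f x) = integral {0..b} (\<lambda>x. p x * s x)"
    using b integral_symmetric_interval[of b "\<lambda>x. p x * f x"] cont contp
    by (simp add: even s_def distrib_left continuous_on_mult)
  ultimately show ?thesis by simp
qed

text \<open>
  The weak-type estimate for the centred maximal function: disjoint intervals are selected by
  Vitali's lemma so that their fivefold enlargements still cover \<open>{a..b}\<close>. An interval of radius \<open>h\<close>
  has an enlargement of length \<open>10 h\<close>, which is the source of the constant.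
\<close>

lemma length_le_integral_of_heavy_intervals:
  fixes f :: "real \<Rightarrow> real"
  assumes ab: "a \<le> b" and B: "0 < B"
    and cont: "continuous_on {a - B..b + B} f"
    and nonneg: "\<And>x. x \<in> {a - B..b + B} \<Longrightarrow> 0 \<le> f x"
    and heavy: "\<And>x. x \<in> {a..b} \<Longrightarrow> \<exists>h. 0 < h \<and> h \<le> B \<and> h \<le> integral {x - h..x + h} f"
  shows "b - a \<le> 10 * integral {a - B..b + B} f"
proof -
  have "\<forall>x\<in>{a..b}. \<exists>h. 0 < h \<and> h \<le> B \<and> h \<le> integral {x - h..x + h} f"
    using heavy by blast
  then obtain r where "\<forall>x\<in>{a..b}. 0 < r x \<and> r x \<le> B \<and> r x \<le> integral {x - r x..x + r x} f"
    by (rule bchoice[THEN exE])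
  then have r: "0 < r x" "r x \<le> B" "r x \<le> integral {x - r x..x + r x} f" if "x \<in> {a..b}" for x
    using that by blast+
  obtain C where C: "C \<subseteq> {a..b}"
      and disj: "pairwise (\<lambda>i j. disjnt (cball i (r i)) (cball j (r j))) C"
      and cov: "\<And>i. i \<in> {a..b} \<Longrightarrow> \<exists>j. j \<in> C \<and> \<not> disjnt (cball i (r i)) (cball j (r j)) \<and>
                        cball i (r i) \<subseteq> ball j (5 * r j)"
  proof (rule Vitali_covering_lemma_cballs_balls[of "{a..b}" r B "\<lambda>x. x"])
    show "0 < r i \<and> r i \<le> B" if "i \<in> {a..b}" for i
      using r(1,2)[OF that] by blast
  qed (use that in blast)
  have "{a..b} \<subseteq> (\<Union>j\<in>C. ball j (5 * r j))"
  proof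
    fix i assume i: "i \<in> {a..b}"
    then obtain j where "j \<in> C" "cball i (r i) \<subseteq> ball j (5 * r j)"
      using cov by blast
    moreover have "i \<in> cball i (r i)"
      using r(1)[OF i] by simp
    ultimately show "i \<in> (\<Union>j\<in>C. ball j (5 * r j))" by blast
  qed
  then obtain D where D: "D \<subseteq> C" "finite D" "{a..b} \<subseteq> (\<Union>j\<in>D. ball j (5 * r j))"
    using compactE_image[of "{a..b}" C "\<lambda>j. ball j (5 * r j)"] by (metis compact_Icc open_ball)
  have Dab: "j \<in> {a..b}" if "j \<in> D" for j
    using that D(1) C by blast
  define I where "I = (\<lambda>j. {j - r j..j + r j})"
  have I_cball: "I j = cball j (r j)" for j
    by (auto simp: I_def dist_real_def)
  have Isub: "I j \<subseteq> {a - B..b + B}" if "j \<in> D" for j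
    using r(1,2)[OF Dab[OF that]] Dab[OF that] by (auto simp: I_def)
  have int: "f integrable_on I j" if "j \<in> D" for j
    unfolding I_def using Isub[OF that]
    by (intro integrable_continuous_real continuous_on_subset[OF cont]) (auto simp: I_def)
  have UN: "(f has_integral (\<Sum>j\<in>D. integral (I j) f)) (\<Union>j\<in>D. I j)"
  proof (rule has_integral_UN)
    show "pairwise (\<lambda>i j. negligible (I i \<inter> I j)) D"
      using pairwise_subset[OF disj D(1)] by (auto simp: pairwise_def disjnt_def I_cball)
  qed (use D(2) int in auto)
  have "b - a = measure lebesgue {a..b}"
    using ab by simp
  also have "\<dots> \<le> measure lebesgue (\<Union>j\<in>D. ball j (5 * r j))"
    using D by (intro measure_mono_fmeasurable) (auto intro: fmeasurable_UN)
  also have "\<dots> \<le> (\<Sum>j\<in>D. measure lebesgue (ball j (5 * r j)))"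
    using D(2) by (intro measure_UNION_le) auto
  also have "\<dots> = (\<Sum>j\<in>D. 10 * r j)"
  proof (rule sum.cong)
    fix j assume "j \<in> D"
    then have "0 < r j"
      using Dab r(1) by blast
    moreover have "ball j (5 * r j) = {j - 5 * r j<..<j + 5 * r j}"
      by (auto simp: dist_real_def)
    ultimately show "measure lebesgue (ball j (5 * r j)) = 10 * r j"
      by simp
  qed simp
  also have "\<dots> \<le> (\<Sum>j\<in>D. 10 * integral (I j) f)"
    using r(3)[OF Dab] by (intro sum_mono) (auto simp: I_def)
  also have "\<dots> = 10 * (\<Sum>j\<in>D. integral (I j) f)"
    by (simp add: sum_distrib_left)
  also have "(\<Sum>j\<in>D. integral (I j) f) = integral (\<Union>j\<in>D. I j) f"
    using UN by (rule integral_unique[symmetric])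
  also have "\<dots> \<le> integral {a - B..b + B} f"
    using Isub nonneg
    by (intro integral_subset_le has_integral_integrable[OF UN] integrable_continuous_real cont) auto
  finally show ?thesis by simp
qed

section \<open>Harnack's inequality and boundary mass\<close>

lemma Poisson_kernel_denominator_pos:
  fixes R \<rho> \<theta> :: real
  assumes "0 \<le> \<rho>" "\<rho> < R"
  shows "(R - \<rho>)\<^sup>2 \<le> R\<^sup>2 - 2 * R * \<rho> * cos \<theta> + \<rho>\<^sup>2"
    and "R\<^sup>2 - 2 * R * \<rho> * cos \<theta> + \<rho>\<^sup>2 \<le> (R + \<rho>)\<^sup>2"
    and "0 < R\<^sup>2 - 2 * R * \<rho> * cos \<theta> + \<rho>\<^sup>2"
proof -
  have "R * \<rho> * cos \<theta> \<le> R * \<rho> * 1"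
    using assms by (intro mult_left_mono[of _ _ "R * \<rho>"]) auto
  moreover have "R * \<rho> * (-1) \<le> R * \<rho> * cos \<theta>"
    using assms by (intro mult_left_mono[of _ _ "R * \<rho>"]) auto
  ultimately show 1: "(R - \<rho>)\<^sup>2 \<le> R\<^sup>2 - 2 * R * \<rho> * cos \<theta> + \<rho>\<^sup>2"
    and "R\<^sup>2 - 2 * R * \<rho> * cos \<theta> + \<rho>\<^sup>2 \<le> (R + \<rho>)\<^sup>2"
    by (auto simp: power2_eq_square algebra_simps)
  have "0 < (R - \<rho>)\<^sup>2"
    using assms by simp
  with 1 show "0 < R\<^sup>2 - 2 * R * \<rho> * cos \<theta> + \<rho>\<^sup>2"
    by linarith
qed

lemma Poisson_kernel_bounds:
  assumes "0 \<le> \<rho>" "\<rho> < R"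
  shows "(R - \<rho>) / (R + \<rho>) \<le> Poisson_kernel R \<rho> \<theta>"
    and "Poisson_kernel R \<rho> \<theta> \<le> (R + \<rho>) / (R - \<rho>)"
proof -
  note den = Poisson_kernel_denominator_pos[OF assms, of \<theta>]
  have sq: "R\<^sup>2 - \<rho>\<^sup>2 = (R - \<rho>) * (R + \<rho>)"
    by (simp add: power2_eq_square algebra_simps)
  have "0 \<le> R\<^sup>2 - \<rho>\<^sup>2"
    using assms by (simp add: sq)
  then have "(R\<^sup>2 - \<rho>\<^sup>2) / (R + \<rho>)\<^sup>2 \<le> Poisson_kernel R \<rho> \<theta>"
    unfolding Poisson_kernel_def using den assms by (intro divide_left_mono) auto
  then show "(R - \<rho>) / (R + \<rho>) \<le> Poisson_kernel R \<rho> \<theta>"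
    using assms by (simp add: sq power2_eq_square[of "R + \<rho>"])
  have "Poisson_kernel R \<rho> \<theta> \<le> (R\<^sup>2 - \<rho>\<^sup>2) / (R - \<rho>)\<^sup>2"
    unfolding Poisson_kernel_def using den assms \<open>0 \<le> R\<^sup>2 - \<rho>\<^sup>2\<close>
    by (intro divide_left_mono) auto
  then show "Poisson_kernel R \<rho> \<theta> \<le> (R + \<rho>) / (R - \<rho>)"
    using assms by (simp add: sq power2_eq_square[of "R - \<rho>"])
qed

lemma has_field_derivative_Poisson_kernel:
  assumes "0 \<le> \<rho>" "\<rho> < R"
  shows "(Poisson_kernel R \<rho> has_real_derivative
            - ((R\<^sup>2 - \<rho>\<^sup>2) * (2 * R * \<rho> * sin \<theta>) / (R\<^sup>2 - 2 * R * \<rho> * cos \<theta> + \<rho>\<^sup>2)\<^sup>2)) (at \<theta>)"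
  unfolding Poisson_kernel_def[abs_def] using Poisson_kernel_denominator_pos(3)[OF assms, of \<theta>]
  by (auto intro!: derivative_eq_intros simp: power2_eq_square)

lemma continuous_on_Re_circle:
  fixes F :: "complex \<Rightarrow> complex"
  assumes "F holomorphic_on cball 0 R" and "0 \<le> R"
  shows "continuous_on A (\<lambda>\<theta>. Re (F (of_real R * cis (a + \<theta>))))"
  by (intro continuous_intros continuous_on_compose2[OF holomorphic_on_imp_continuous_on[OF assms(1)]])
     (use assms(2) in \<open>auto simp: norm_mult\<close>)

lemma integral_shift_centred:
  fixes f :: "real \<Rightarrow> real"
  shows "integral {- h..h} (\<lambda>\<theta>. f (a + \<theta>)) = integral {a - h..a + h} f"
proof (cases "f integrable_on {a - h..a + h}")
  case True
  then have "(f has_integral integral {a - h..a + h} f) (cbox (- h + a) (h + a))"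
    by (simp add: integrable_integral add.commute)
  then have "((f \<circ> (+) a) has_integral integral {a - h..a + h} f) (cbox (- h) h)"
    by (simp only: has_integral_shift_cbox_iff)
  then show ?thesis
    by (simp add: o_def integral_unique)
next
  case False
  have "\<not> (\<lambda>\<theta>. f (a + \<theta>)) integrable_on {- h..h}"
  proof
    assume "(\<lambda>\<theta>. f (a + \<theta>)) integrable_on {- h..h}"
    then obtain I where "((f \<circ> (+) a) has_integral I) (cbox (- h) h)"
      by (auto simp: integrable_on_def o_def)
    then have "(f has_integral I) (cbox (- h + a) (h + a))"
      by (simp only: has_integral_shift_cbox_iff)
    then show False
      using False by (auto simp: integrable_on_def add.commute)
  qed
  with False show ?thesis
    by (simp add: not_integrable_integral)
qed

lemma circle_mean_value:
  fixes F :: "complex \<Rightarrow> complex"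
  assumes "F holomorphic_on cball 0 R" and "0 < R"
  shows "integral {a - pi..a + pi} (\<lambda>\<theta>. Re (F (of_real R * cis \<theta>))) = 2 * pi * Re (F 0)"
  using Poisson_integral[OF assms(1), of 0 a] assms(2)
    integral_shift_centred[of pi "\<lambda>\<theta>. Re (F (of_real R * cis \<theta>))" a]
  by (simp add: Poisson_kernel_def integral_unique)

lemma Harnack_circle:
  fixes F :: "complex \<Rightarrow> complex"
  assumes holF: "F holomorphic_on cball 0 R" and nonneg: "\<And>z. norm z = R \<Longrightarrow> 0 \<le> Re (F z)"
    and z: "norm z < R"
  shows "(R - norm z) / (R + norm z) * Re (F 0) \<le> Re (F z)"
    and "Re (F z) \<le> (R + norm z) / (R - norm z) * Re (F 0)"
proof -
  have R: "0 < R"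
    using z norm_ge_zero le_less_trans by blast
  define f where "f = (\<lambda>\<theta>. Re (F (of_real R * cis (Arg z + \<theta>))))"
  have f: "0 \<le> f \<theta>" for \<theta>
    unfolding f_def using R by (intro nonneg) (simp add: norm_mult)
  have P: "((\<lambda>\<theta>. Poisson_kernel R (norm z) \<theta> * f \<theta>) has_integral 2 * pi * Re (F z)) {-pi..pi}"
    using Poisson_integral[OF holF, of "norm z" "Arg z"] z
    by (simp add: f_def rcis_cmod_Arg flip: rcis_def)
  have M: "((\<lambda>\<theta>. c * f \<theta>) has_integral c * (2 * pi * Re (F 0))) {-pi..pi}" for c
  proof -
    have "(f has_integral 2 * pi * Re (F 0)) {-pi..pi}"
      using Poisson_integral[OF holF, of 0 "Arg z"] R by (simp add: f_def Poisson_kernel_def)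
    then show ?thesis
      by (rule has_integral_mult_right)
  qed
  have "(R - norm z) / (R + norm z) * (2 * pi * Re (F 0)) \<le> 2 * pi * Re (F z)"
    using Poisson_kernel_bounds(1)[of "norm z" R] z f
    by (intro has_integral_le[OF M P] mult_right_mono) auto
  then have "(2 * pi) * ((R - norm z) / (R + norm z) * Re (F 0)) \<le> (2 * pi) * Re (F z)"
    by (simp only: mult_ac)
  then show "(R - norm z) / (R + norm z) * Re (F 0) \<le> Re (F z)"
    by (rule mult_left_le_imp_le) auto
  have "2 * pi * Re (F z) \<le> (R + norm z) / (R - norm z) * (2 * pi * Re (F 0))"
    using Poisson_kernel_bounds(2)[of "norm z" R] z f
    by (intro has_integral_le[OF P M] mult_right_mono) auto
  then have "(2 * pi) * Re (F z) \<le> (2 * pi) * ((R + norm z) / (R - norm z) * Re (F 0))"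
    by (simp only: mult_ac)
  then show "Re (F z) \<le> (R + norm z) / (R - norm z) * Re (F 0)"
    by (rule mult_left_le_imp_le) auto
qed

text \<open>
  The bounds on the circle of radius \<open>R\<close> persist in the limit \<open>R \<rightarrow> 1\<close>, which frees \<open>F\<close> from any
  boundary regularity.
\<close>

theorem Harnack_disc:
  fixes F :: "complex \<Rightarrow> complex"
  assumes holF: "F holomorphic_on ball 0 1" and nonneg: "\<And>z. z \<in> ball 0 1 \<Longrightarrow> 0 \<le> Re (F z)"
    and z: "norm z < 1"
  shows "(1 - norm z) / (1 + norm z) * Re (F 0) \<le> Re (F z)"
    and "Re (F z) \<le> (1 + norm z) / (1 - norm z) * Re (F 0)"
proof -
  have ev: "\<forall>\<^sub>F R in at_left 1. norm z < R \<and> R < (1::real)"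
    using z by (auto simp: eventually_at_left)
  have hol: "F holomorphic_on cball 0 R" if "R < 1" for R
    using that by (intro holomorphic_on_subset[OF holF]) auto
  have nz: "1 + norm z \<noteq> 0" "1 - norm z \<noteq> 0"
    using z norm_ge_zero[of z] by linarith+
  have "((\<lambda>R. (R - norm z) / (R + norm z) * Re (F 0)) \<longlongrightarrow> (1 - norm z) / (1 + norm z) * Re (F 0)) (at_left 1)"
    using nz by (intro tendsto_intros)
  then show "(1 - norm z) / (1 + norm z) * Re (F 0) \<le> Re (F z)"
  proof (rule tendsto_upperbound)
    show "\<forall>\<^sub>F R in at_left 1. (R - norm z) / (R + norm z) * Re (F 0) \<le> Re (F z)"
      using ev
    proof eventually_elim
      case (elim R)
      show ?case
        by (rule Harnack_circle(1)[OF hol]) (use elim nonneg in auto)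
    qed
  qed auto
  have "((\<lambda>R. (R + norm z) / (R - norm z) * Re (F 0)) \<longlongrightarrow> (1 + norm z) / (1 - norm z) * Re (F 0)) (at_left 1)"
    using nz by (intro tendsto_intros)
  then show "Re (F z) \<le> (1 + norm z) / (1 - norm z) * Re (F 0)"
  proof (rule tendsto_lowerbound)
    show "\<forall>\<^sub>F R in at_left 1. Re (F z) \<le> (R + norm z) / (R - norm z) * Re (F 0)"
      using ev
    proof eventually_elim
      case (elim R)
      show ?case
        by (rule Harnack_circle(2)[OF hol]) (use elim nonneg in auto)
    qed
  qed auto
qed

text \<open>
  If the mean of \<open>U = Re F\<close> over every arc centred at angle \<open>a\<close> were at most \<open>1 / 2\<close>, the Poisson integral,
  whose kernel is even and decreasing with mean \<open>1\<close>, would give \<open>U \<le> 1 / 2\<close> at every point of the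
  corresponding radius.
\<close>

lemma heavy_arc:
  fixes F :: "complex \<Rightarrow> complex"
  assumes holF: "F holomorphic_on cball 0 R" and \<rho>: "0 \<le> \<rho>" "\<rho> < R"
    and ge1: "1 \<le> Re (F (of_real \<rho> * cis a))"
  shows "\<exists>h. 0 < h \<and> h \<le> pi \<and> h \<le> integral {a - h..a + h} (\<lambda>\<theta>. Re (F (of_real R * cis \<theta>)))"
proof (rule ccontr)
  assume "\<not> ?thesis"
  then have light: "integral {a - h..a + h} (\<lambda>\<theta>. Re (F (of_real R * cis \<theta>))) \<le> h" if "0 < h" "h \<le> pi" for h
    using that by (meson linear)
  define f where "f = (\<lambda>\<theta>. Re (F (of_real R * cis (a + \<theta>))))"
  define p where "p = Poisson_kernel R \<rho>"
  have cont: "continuous_on A f" for A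
    unfolding f_def using \<rho> by (intro continuous_on_Re_circle[OF holF]) auto
  have "integral {-pi..pi} (\<lambda>\<theta>. p \<theta> * (f \<theta> - 1 / 2)) \<le> 0"
  proof (rule integral_even_decreasing_mult_nonpos)
    show "continuous_on {-pi..pi} (\<lambda>\<theta>. f \<theta> - 1 / 2)"
      by (intro continuous_intros cont)
    show "(p has_real_derivative
            - ((R\<^sup>2 - \<rho>\<^sup>2) * (2 * R * \<rho> * sin \<theta>) / (R\<^sup>2 - 2 * R * \<rho> * cos \<theta> + \<rho>\<^sup>2)\<^sup>2)) (at \<theta>)" for \<theta>
      unfolding p_def by (rule has_field_derivative_Poisson_kernel[OF \<rho>])
    show "p (- \<theta>) = p \<theta>" for \<theta>
      by (simp add: p_def Poisson_kernel_def)
    show "- ((R\<^sup>2 - \<rho>\<^sup>2) * (2 * R * \<rho> * sin \<theta>) / (R\<^sup>2 - 2 * R * \<rho> * cos \<theta> + \<rho>\<^sup>2)\<^sup>2) \<le> 0"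
      if "\<theta> \<in> {0..pi}" for \<theta>
    proof -
      have "0 \<le> sin \<theta>"
        using that by (auto intro: sin_ge_zero)
      moreover have "0 \<le> R\<^sup>2 - \<rho>\<^sup>2"
        using \<rho> by (simp add: power_mono)
      ultimately show ?thesis
        using \<rho> by simp
    qed
    have "0 \<le> (R - \<rho>) / (R + \<rho>)"
      using \<rho> by simp
    then show "0 \<le> p pi"
      unfolding p_def using Poisson_kernel_bounds(1)[OF \<rho>, of pi] by linarith
    show "integral {- h..h} (\<lambda>\<theta>. f \<theta> - 1 / 2) \<le> 0" if "0 < h" "h \<le> pi" for h
    proof -
      have "integral {- h..h} (\<lambda>\<theta>. f \<theta> - 1 / 2) = integral {- h..h} f - integral {- h..h} (\<lambda>\<theta>. 1 / 2)"
        by (intro integral_diff integrable_continuous_real cont continuous_intros)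
      also have "integral {- h..h} f = integral {a - h..a + h} (\<lambda>\<theta>. Re (F (of_real R * cis \<theta>)))"
        unfolding f_def by (rule integral_shift_centred)
      also have "\<dots> - integral {- h..h} (\<lambda>\<theta>. 1 / 2) \<le> 0"
        using light[OF that] that by simp
      finally show ?thesis .
    qed
  qed auto
  moreover have "integral {-pi..pi} (\<lambda>\<theta>. p \<theta> * (f \<theta> - 1 / 2)) = 2 * pi * Re (F (of_real \<rho> * cis a)) - pi"
  proof (rule integral_unique)
    have 1: "((\<lambda>\<theta>. p \<theta> * f \<theta>) has_integral 2 * pi * Re (F (of_real \<rho> * cis a))) {-pi..pi}"
      unfolding p_def f_def by (rule Poisson_integral[OF holF \<rho>])
    have 2: "((\<lambda>\<theta>. p \<theta> * (1 / 2)) has_integral pi) {-pi..pi}"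
      using Poisson_integral[of "\<lambda>_. 1 / 2" R \<rho> a] \<rho> by (simp add: p_def)
    show "((\<lambda>\<theta>. p \<theta> * (f \<theta> - 1 / 2)) has_integral (2 * pi * Re (F (of_real \<rho> * cis a)) - pi)) {-pi..pi}"
      using has_integral_diff[OF 1 2] by (simp only: right_diff_distrib)
  qed
  ultimately have "2 * pi * Re (F (of_real \<rho> * cis a)) \<le> pi"
    by linarith
  moreover have "pi * 2 \<le> 2 * pi * Re (F (of_real \<rho> * cis a))"
    using ge1 by simp
  ultimately show False
    using pi_gt_zero by linarith
qed

section \<open>Positive harmonic functions along a path to the boundary\<close>

lemma norm_cis_diff_le: "norm (cis u - cis v) \<le> \<bar>u - v\<bar>"
proof -
  have "cis u - cis v = cis v * (exp (\<i> * of_real (u - v)) - 1)"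
    by (simp add: cis_conv_exp ring_distribs flip: exp_add)
  then have "norm (cis u - cis v) = 2 * \<bar>sin ((u - v) / 2)\<bar>"
    by (simp only: norm_mult norm_cis mult_1_left dist_exp_i_1)
  then show ?thesis
    using abs_sin_x_le_abs_x[of "(u - v) / 2"] by simp
qed

text \<open>
  Let \<open>d = \<bar>x t - \<tau>\<bar>\<close>. If \<open>U = Re F\<close> is not already bounded below at \<open>0\<close> by a multiple of \<open>d\<close>, then
  Harnack's inequality keeps the whole path within \<open>d / 8\<close> of the circle. The radial
  projection of the path then turns through an angle of at least \<open>d / 2\<close>, because it starts near
  \<open>x t\<close> and comes arbitrarily near \<open>\<tau>\<close>. Every angle it passes is the centre of a heavy arc, and the
  covering lemma bounds \<open>d / 2\<close> by ten times the mass of \<open>U\<close> on two full turns, that is, by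
  \<open>40 \<pi> U 0\<close>.
\<close>

theorem path_to_boundary_point_bound:
  fixes F :: "complex \<Rightarrow> complex" and x :: "real \<Rightarrow> complex"
  assumes holF: "F holomorphic_on ball 0 1" and nonneg: "\<And>z. z \<in> ball 0 1 \<Longrightarrow> 0 \<le> Re (F z)"
    and contx: "continuous_on {t..} x" and x: "\<And>s. t \<le> s \<Longrightarrow> x s \<in> ball 0 1"
    and lim: "(x \<longlongrightarrow> \<tau>) at_top" and \<tau>: "norm \<tau> = 1"
    and ge1: "\<And>s. t \<le> s \<Longrightarrow> 1 \<le> Re (F (x s))"
  shows "norm (x t - \<tau>) \<le> 80 * pi * Re (F 0)"
proof -
  define U0 where "U0 = Re (F 0)"
  define d where "d = norm (x t - \<tau>)"
  have U0: "0 \<le> U0"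
    using nonneg[of 0] by (simp add: U0_def)
  have pi80: "16 * U0 \<le> 80 * pi * U0"
    using U0 pi_ge_two by (intro mult_right_mono) auto
  have Harnack: "1 \<le> 2 / (1 - norm (x s)) * U0" if "t \<le> s" for s
  proof -
    have n: "norm (x s) < 1"
      using x[OF that] by simp
    have "1 \<le> (1 + norm (x s)) / (1 - norm (x s)) * U0"
      using Harnack_disc(2)[OF holF nonneg n] ge1[OF that] by (simp add: U0_def)
    also have "\<dots> \<le> 2 / (1 - norm (x s)) * U0"
      using n U0 by (intro mult_right_mono divide_right_mono) auto
    finally show ?thesis .
  qed
  have deep: "1 - norm (x s) \<le> 2 * U0" if "t \<le> s" for s
  proof -
    have "norm (x s) < 1"
      using x[OF that] by simp
    then show ?thesis
      using Harnack[OF that] by (simp add: field_simps)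
  qed
  have d2: "d \<le> 2"
    using norm_triangle_ineq4[of "x t" \<tau>] x[of t] \<tau> by (simp add: d_def)
  show ?thesis
  proof (cases "d \<le> 16 * U0")
    case True
    then show ?thesis
      using pi80 by (simp add: d_def U0_def)
  next
    case False
    then have small: "U0 < d / 16" and d0: "0 < d"
      using U0 by auto
    have big: "1 - norm (x s) < d / 8" if "t \<le> s" for s
      using deep[OF that] small by linarith
    obtain T where T: "t \<le> T" "norm (x T - \<tau>) < d / 8"
    proof -
      have "\<forall>\<^sub>F s in at_top. dist (x s) \<tau> < d / 8"
        using lim d0 by (intro tendstoD) auto
      then obtain N where "\<forall>s\<ge>N. dist (x s) \<tau> < d / 8"
        by (auto simp: eventually_at_top_linorder)
      then show ?thesis
        using that[of "max t N"] by (simp add: dist_norm)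
    qed
    have contT: "continuous_on {t..T} x"
      by (rule continuous_on_subset[OF contx]) auto
    have nz: "x s \<noteq> 0" if "s \<in> {t..T}" for s
      using big[of s] d2 that by auto
    \<comment> \<open>A continuous logarithm provides a continuous choice of the angle along the path.\<close>
    obtain L where L: "continuous_on {t..T} L" "\<And>s. s \<in> {t..T} \<Longrightarrow> x s = exp (L s)"
      using continuous_logarithm_on_contractible[OF contT convex_imp_contractible nz] by auto
    define a where "a = (\<lambda>s. Im (L s))"
    have conta: "continuous_on {t..T} a"
      unfolding a_def by (intro continuous_intros L)
    have polar: "x s = of_real (norm (x s)) * cis (a s)" if "s \<in> {t..T}" for s
      using L(2)[OF that] by (simp add: a_def exp_eq_polar norm_mult)
    have radial: "norm (cis (a s) - x s) < d / 8" if "s \<in> {t..T}" for s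
    proof -
      have "cis (a s) - x s = of_real (1 - norm (x s)) * cis (a s)"
        using polar[OF that] by (simp add: algebra_simps)
      then have "norm (cis (a s) - x s) = \<bar>1 - norm (x s)\<bar>"
        by (simp only: norm_mult norm_of_real norm_cis mult_1_right)
      then show ?thesis
        using big[of s] x[of s] that by simp
    qed
    have "d = norm ((cis (a t) - cis (a T)) - (cis (a t) - x t) + (cis (a T) - x T) + (x T - \<tau>))"
      by (simp add: d_def)
    also have "\<dots> \<le> norm (cis (a t) - cis (a T)) + norm (cis (a t) - x t) + norm (cis (a T) - x T) + norm (x T - \<tau>)"
      by norm
    also have "\<dots> \<le> \<bar>a t - a T\<bar> + d / 8 + d / 8 + d / 8"
      using norm_cis_diff_le[of "a t" "a T"] radial[of t] radial[of T] T by simp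
    finally have turn: "d / 2 \<le> \<bar>a t - a T\<bar>"
      using d0 by linarith
    define \<alpha> where "\<alpha> = min (a t) (a T)"
    have angles: "\<exists>s\<in>{t..T}. a s = \<theta>" if "\<theta> \<in> {\<alpha>..\<alpha> + d / 2}" for \<theta>
    proof -
      have "connected (a ` {t..T})"
        by (intro connected_continuous_image conta) auto
      moreover have "a t \<in> a ` {t..T}" "a T \<in> a ` {t..T}"
        using T by auto
      moreover have "\<theta> \<in> {min (a t) (a T)..max (a t) (a T)}"
        using that turn by (auto simp: \<alpha>_def min_def max_def split: if_splits)
      ultimately have "\<theta> \<in> a ` {t..T}"
        unfolding connected_iff_interval by (auto simp: min_def max_def split: if_splits)
      then show ?thesis by auto
    qed
    \<comment> \<open>\<open>F\<close> has no boundary values, so the mass is measured on a circle enclosing the path up to time \<open>T\<close>.\<close>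
    obtain R where R: "R < 1" "\<And>s. s \<in> {t..T} \<Longrightarrow> norm (x s) < R"
    proof -
      have "\<exists>s0\<in>{t..T}. \<forall>s\<in>{t..T}. norm (x s) \<le> norm (x s0)"
        by (rule continuous_attains_sup) (use T in \<open>auto intro!: continuous_intros contT\<close>)
      then obtain s0 where s0: "s0 \<in> {t..T}" "\<And>s. s \<in> {t..T} \<Longrightarrow> norm (x s) \<le> norm (x s0)"
        by blast
      have "norm (x s0) < 1"
        using s0(1) x by auto
      then obtain R where "norm (x s0) < R" "R < 1"
        using dense by blast
      then show ?thesis
        using that s0(2) le_less_trans by blast
    qed
    have "norm (x t) < R"
      using R(2) T by simp
    then have R0: "0 < R"
      using norm_ge_zero le_less_trans by blast
    have hol: "F holomorphic_on cball 0 R"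
      using R(1) by (intro holomorphic_on_subset[OF holF]) auto
    define f where "f = (\<lambda>\<theta>. Re (F (of_real R * cis \<theta>)))"
    have contf: "continuous_on A f" for A
      using continuous_on_Re_circle[OF hol, of A 0] R0 by (simp add: f_def)
    have f0: "0 \<le> f \<theta>" for \<theta>
      unfolding f_def using R R0 by (intro nonneg) (simp add: norm_mult)
    have intf: "f integrable_on {u..v}" for u v
      by (intro integrable_continuous_real contf)
    have "(\<alpha> + d / 2) - \<alpha> \<le> 10 * integral {\<alpha> - pi..\<alpha> + d / 2 + pi} f"
    proof (rule length_le_integral_of_heavy_intervals)
      show "\<exists>h. 0 < h \<and> h \<le> pi \<and> h \<le> integral {\<theta> - h..\<theta> + h} f" if \<theta>: "\<theta> \<in> {\<alpha>..\<alpha> + d / 2}" for \<theta>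
      proof -
        obtain s where s: "s \<in> {t..T}" "a s = \<theta>"
          using angles[OF \<theta>] by blast
        then have "1 \<le> Re (F (of_real (norm (x s)) * cis \<theta>))"
          using ge1[of s] polar[of s] by simp
        then show ?thesis
          unfolding f_def using R(2)[OF s(1)] by (intro heavy_arc[OF hol]) auto
      qed
    qed (use d0 f0 contf in auto)
    \<comment> \<open>Since \<open>d / 2 \<le> 1\<close>, two full turns contain all the heavy arcs.\<close>
    also have "integral {\<alpha> - pi..\<alpha> + d / 2 + pi} f \<le> integral {\<alpha> - pi..\<alpha> + 2 * pi + pi} f"
      using d2 pi_ge_two f0 by (intro integral_subset_le intf) auto
    also have "\<dots> = integral {\<alpha> - pi..\<alpha> + pi} f + integral {\<alpha> + 2 * pi - pi..\<alpha> + 2 * pi + pi} f"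
      using Henstock_Kurzweil_Integration.integral_combine[where a = "\<alpha> - pi" and c = "\<alpha> + pi" and b = "\<alpha> + 2 * pi + pi" and f = f] intf
      by (simp add: algebra_simps)
    also have "\<dots> = 4 * pi * U0"
      unfolding f_def using circle_mean_value[OF hol R0] by (simp only: U0_def)
    finally show ?thesis
      by (simp add: d_def U0_def)
  qed
qed

text \<open>
  With the point \<open>\<tau>\<close> of the circle sent to \<open>0\<close> in a half-plane with coordinate \<open>\<zeta> = 1 - cnj \<tau> w\<close>, this is
  \<open>4 \<epsilon> / (\<epsilon> + \<zeta>)\<close>. Its real part is a substitute for the harmonic measure of an arc of length about
  \<open>\<epsilon>\<close> around \<open>\<tau>\<close>: it is positive, at least \<open>1\<close> within distance \<open>\<epsilon>\<close> of \<open>\<tau>\<close>, and of order \<open>\<epsilon>\<close> at a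
  fixed interior point.
\<close>

definition boundary_peak :: "complex \<Rightarrow> real \<Rightarrow> complex \<Rightarrow> complex" where
  "boundary_peak \<tau> \<epsilon> w = 4 * of_real \<epsilon> / (1 + of_real \<epsilon> - cnj \<tau> * w)"

lemma boundary_peak_denominator:
  assumes "norm \<tau> = 1"
  shows "\<epsilon> + (1 - norm w) \<le> Re (1 + of_real \<epsilon> - cnj \<tau> * w)"
    and "norm (1 - cnj \<tau> * w) = norm (w - \<tau>)"
proof -
  show "\<epsilon> + (1 - norm w) \<le> Re (1 + of_real \<epsilon> - cnj \<tau> * w)"
    using complex_Re_le_cmod[of "cnj \<tau> * w"] assms by (simp add: norm_mult)
  have "cnj \<tau> * \<tau> = 1"
    using assms complex_norm_square[of \<tau>] by (simp add: mult.commute)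
  then have "1 - cnj \<tau> * w = cnj \<tau> * (\<tau> - w)"
    by (simp add: algebra_simps)
  then show "norm (1 - cnj \<tau> * w) = norm (w - \<tau>)"
    using assms by (simp add: norm_mult norm_minus_commute)
qed

lemma holomorphic_on_boundary_peak:
  assumes "norm \<tau> = 1" "0 < \<epsilon>"
  shows "boundary_peak \<tau> \<epsilon> holomorphic_on ball 0 1"
proof -
  have "1 + of_real \<epsilon> - cnj \<tau> * w \<noteq> 0" if "w \<in> ball 0 1" for w
  proof
    assume eq: "1 + of_real \<epsilon> - cnj \<tau> * w = 0"
    have "\<epsilon> + (1 - norm w) \<le> 0"
      using boundary_peak_denominator(1)[OF assms(1), of \<epsilon> w] unfolding eq by simp
    with that assms show False by simp
  qed
  then show ?thesis
    unfolding boundary_peak_def[abs_def] by (intro holomorphic_intros) auto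
qed

text \<open>
  The last estimate shows that a point where the peak function is not small lies within a multiple
  of \<open>\<epsilon>\<close> of \<open>\<tau>\<close>.
\<close>

lemma boundary_peak:
  fixes \<tau> w :: complex
  assumes \<tau>: "norm \<tau> = 1" and \<epsilon>: "0 < \<epsilon>" and w: "norm w < 1"
  shows "0 \<le> Re (boundary_peak \<tau> \<epsilon> w)"
    and "norm (w - \<tau>) \<le> \<epsilon> \<Longrightarrow> 1 \<le> Re (boundary_peak \<tau> \<epsilon> w)"
    and "Re (boundary_peak \<tau> \<epsilon> w) * (1 - norm w) \<le> 4 * \<epsilon>"
    and "Re (boundary_peak \<tau> \<epsilon> w) * norm (w - \<tau>) \<le> (4 + Re (boundary_peak \<tau> \<epsilon> w)) * \<epsilon>"
proof -
  define D where "D = 1 + of_real \<epsilon> - cnj \<tau> * w"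
  let ?F = "boundary_peak \<tau> \<epsilon> w"
  note dist = boundary_peak_denominator(2)[OF \<tau>, of w]
  have ReD: "\<epsilon> + (1 - norm w) \<le> Re D"
    unfolding D_def by (rule boundary_peak_denominator(1)[OF \<tau>])
  then have ReD_pos: "\<epsilon> < Re D"
    using w by linarith
  then have D_nz: "D \<noteq> 0"
    using \<epsilon> by auto
  have F: "?F = 4 * of_real \<epsilon> / D"
    by (simp add: D_def boundary_peak_def)
  have ReF: "Re ?F = 4 * \<epsilon> * Re D / (norm D)\<^sup>2"
    by (simp add: F Re_divide cmod_power2)
  show nonneg: "0 \<le> Re ?F"
    using ReD_pos \<epsilon> by (simp add: ReF)
  show "1 \<le> Re ?F" if close: "norm (w - \<tau>) \<le> \<epsilon>"
  proof -
    have "norm D \<le> norm (of_real \<epsilon> :: complex) + norm (1 - cnj \<tau> * w)"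
      using norm_triangle_ineq[of "of_real \<epsilon>" "1 - cnj \<tau> * w"] by (simp add: D_def algebra_simps)
    then have "norm D \<le> 2 * \<epsilon>"
      using close \<epsilon> by (simp add: dist)
    then have "(norm D)\<^sup>2 \<le> (2 * \<epsilon>)\<^sup>2"
      by (intro power_mono) auto
    also have "\<dots> = 4 * \<epsilon> * \<epsilon>"
      by (simp add: power2_eq_square)
    also have "\<dots> \<le> 4 * \<epsilon> * Re D"
      using ReD_pos \<epsilon> by simp
    finally show ?thesis
      using D_nz by (simp add: ReF)
  qed
  have ReF_norm: "Re ?F * norm D \<le> 4 * \<epsilon>"
  proof -
    have "Re ?F \<le> norm ?F"
      by (rule complex_Re_le_cmod)
    also have "\<dots> = 4 * \<epsilon> / norm D"
      using \<epsilon> by (simp add: F norm_divide norm_mult)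
    finally show ?thesis
      using D_nz by (simp add: field_simps)
  qed
  show "Re ?F * (1 - norm w) \<le> 4 * \<epsilon>"
  proof -
    have "1 - norm w \<le> norm D"
      using ReD complex_Re_le_cmod[of D] \<epsilon> by linarith
    then have "Re ?F * (1 - norm w) \<le> Re ?F * norm D"
      using nonneg by (rule mult_left_mono)
    with ReF_norm show ?thesis by linarith
  qed
  show "Re ?F * norm (w - \<tau>) \<le> (4 + Re ?F) * \<epsilon>"
  proof -
    have "norm (w - \<tau>) \<le> norm D + norm (of_real \<epsilon> :: complex)"
      unfolding dist[symmetric] using norm_triangle_ineq4[of D "of_real \<epsilon>"]
      by (simp add: D_def algebra_simps)
    then have "norm (w - \<tau>) \<le> norm D + \<epsilon>"
      using \<epsilon> by simp
    then have "Re ?F * norm (w - \<tau>) \<le> Re ?F * (norm D + \<epsilon>)"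
      using nonneg by (rule mult_left_mono)
    with ReF_norm show ?thesis
      by (simp add: algebra_simps)
  qed
qed

section \<open>The projection onto a diameter\<close>

lemma hyperbolic_dist_less_iff:
  fixes z u v :: complex
  assumes "norm z < 1" "norm u < 1" "norm v < 1"
  shows "hyperbolic_dist z u < hyperbolic_dist z v \<longleftrightarrow>
           norm (Moebius_function 0 z u) < norm (Moebius_function 0 z v)"
proof -
  have T: "norm (Moebius_function 0 z w) < 1" if "norm w < 1" for w
    using that assms(1) by (rule Moebius_function_norm_lt_1[rotated])
  have iff: "1 / 2 * ln ((1 + a) / (1 - a)) < 1 / 2 * ln ((1 + b) / (1 - b)) \<longleftrightarrow> a < b"
    if "0 \<le> a" "a < 1" "0 \<le> b" "b < 1" for a b :: real
  proof -
    have "1 / 2 * ln ((1 + a) / (1 - a)) < 1 / 2 * ln ((1 + b) / (1 - b)) \<longleftrightarrow>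
            (1 + a) / (1 - a) < (1 + b) / (1 - b)"
      using that by (simp add: ln_less_cancel_iff)
    also have "\<dots> \<longleftrightarrow> a < b"
      using that by (simp add: divide_simps) (auto simp: algebra_simps)
    finally show ?thesis .
  qed
  show ?thesis
    unfolding hyperbolic_dist_def using T assms by (intro iff) auto
qed

lemma norm_cnj_mult_less_one:
  fixes z w :: complex
  assumes "norm z < 1" "norm w < 1"
  shows "norm (cnj z * w) < 1"
  using mult_left_le[of "norm w" "norm z"] assms by (simp add: norm_mult)

lemma Moebius_function_norm_sq:
  assumes "norm z < 1" "norm w < 1"
  shows "1 - (norm (Moebius_function 0 z w))\<^sup>2 =
           (1 - (norm z)\<^sup>2) * (1 - (norm w)\<^sup>2) / (norm (1 - cnj z * w))\<^sup>2"
proof -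
  have "norm (cnj z * w) < 1"
    using assms by (rule norm_cnj_mult_less_one)
  then have ne: "1 - cnj z * w \<noteq> 0"
    by auto
  have sq: "of_real ((norm u)\<^sup>2) = u * cnj u" for u :: complex
    by (rule complex_norm_square)
  have "of_real ((norm (1 - cnj z * w))\<^sup>2 - (norm (w - z))\<^sup>2) = (of_real ((1 - (norm z)\<^sup>2) * (1 - (norm w)\<^sup>2)) :: complex)"
    unfolding of_real_diff of_real_mult of_real_1 sq by (simp add: algebra_simps)
  then have "(norm (1 - cnj z * w))\<^sup>2 - (norm (w - z))\<^sup>2 = (1 - (norm z)\<^sup>2) * (1 - (norm w)\<^sup>2)"
    by (simp only: of_real_eq_iff)
  then have "(1 - (norm z)\<^sup>2) * (1 - (norm w)\<^sup>2) / (norm (1 - cnj z * w))\<^sup>2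
      = 1 - (norm (w - z))\<^sup>2 / (norm (1 - cnj z * w))\<^sup>2"
    using ne by (simp add: diff_divide_distrib flip: \<open>_ = (1 - (norm z)\<^sup>2) * _\<close>)
  moreover have "(norm (Moebius_function 0 z w))\<^sup>2 = (norm (w - z))\<^sup>2 / (norm (1 - cnj z * w))\<^sup>2"
    by (simp add: Moebius_function_simple norm_divide power_divide)
  ultimately show ?thesis by simp
qed

text \<open>
  Minimising the hyperbolic distance to \<open>z\<close> thus amounts to minimising a quotient that is rational
  in the real parameter of the diameter.
\<close>

lemma hyperbolic_dist_less_iff_quotient:
  fixes z u v :: complex
  assumes "norm z < 1" "norm u < 1" "norm v < 1"
  shows "hyperbolic_dist z u < hyperbolic_dist z v \<longleftrightarrow>
           (norm (1 - cnj z * u))\<^sup>2 / (1 - (norm u)\<^sup>2) < (norm (1 - cnj z * v))\<^sup>2 / (1 - (norm v)\<^sup>2)"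
proof -
  have pos: "0 < 1 - (norm w)\<^sup>2" if "norm w < 1" for w :: complex
    using that by (simp add: power_less_one_iff abs_square_less_1)
  have ne: "0 < (norm (1 - cnj z * w))\<^sup>2" if "norm w < 1" for w
  proof -
    have "norm (cnj z * w) < 1"
      using assms(1) that by (rule norm_cnj_mult_less_one)
    then show ?thesis by auto
  qed
  have "norm (Moebius_function 0 z u) < norm (Moebius_function 0 z v) \<longleftrightarrow>
          1 - (norm (Moebius_function 0 z v))\<^sup>2 < 1 - (norm (Moebius_function 0 z u))\<^sup>2"
    using power_strict_mono[of "norm (Moebius_function 0 z u)" "norm (Moebius_function 0 z v)" 2]
      power_less_imp_less_base[of "norm (Moebius_function 0 z u)" 2 "norm (Moebius_function 0 z v)"] by auto
  also have "\<dots> \<longleftrightarrow> (1 - (norm v)\<^sup>2) / (norm (1 - cnj z * v))\<^sup>2 < (1 - (norm u)\<^sup>2) / (norm (1 - cnj z * u))\<^sup>2"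
    unfolding Moebius_function_norm_sq[OF assms(1,2)] Moebius_function_norm_sq[OF assms(1,3)]
    using mult_less_cancel_left_pos[OF pos[OF assms(1)]] by (simp flip: times_divide_eq_right)
  also have "\<dots> \<longleftrightarrow> (norm (1 - cnj z * u))\<^sup>2 / (1 - (norm u)\<^sup>2) < (norm (1 - cnj z * v))\<^sup>2 / (1 - (norm v)\<^sup>2)"
    using pos[OF assms(2)] pos[OF assms(3)] ne[OF assms(2)] ne[OF assms(3)]
    by (simp add: divide_simps mult.commute)
  finally show ?thesis
    using hyperbolic_dist_less_iff[OF assms] by blast
qed

text \<open>
  In terms of \<open>m = (1 + r) / (1 - r)\<close>, the exponential of twice the signed hyperbolic distance of
  \<open>r \<tau>\<close> from \<open>0\<close>, the quotient is an affine function of \<open>B\<^sup>2 m + A\<^sup>2 / m\<close>. Completing the square exhibits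
  \<open>m = A / B\<close> as the unique minimum.
\<close>

lemma quotient_on_diameter:
  fixes z \<tau> :: complex
  assumes \<tau>: "norm \<tau> = 1" and r: "r \<in> {-1<..<1}"
  defines "A \<equiv> norm (z + \<tau>)" and "B \<equiv> norm (z - \<tau>)" and "m \<equiv> (1 + r) / (1 - r)"
  shows "(norm (1 - cnj z * (of_real r * \<tau>)))\<^sup>2 / (1 - (norm (of_real r * \<tau>))\<^sup>2)
           = (1 - (norm z)\<^sup>2) / 2 + A * B / 2 + (B * m - A)\<^sup>2 / (4 * m)"
proof -
  define x where "x = Re (cnj z * \<tau>)"
  define s where "s = (norm z)\<^sup>2"
  have nt: "Re \<tau> * Re \<tau> + Im \<tau> * Im \<tau> = 1"
    using \<tau> cmod_power2[of \<tau>] by (simp add: power2_eq_square)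
  have A2: "A\<^sup>2 = 1 + s + 2 * x" and B2: "B\<^sup>2 = 1 + s - 2 * x"
    using nt unfolding A_def B_def s_def x_def cmod_power2
    by (simp_all add: power2_eq_square algebra_simps)
  have q: "(norm (1 - cnj z * (of_real r * \<tau>)))\<^sup>2 = 1 - 2 * r * x + r\<^sup>2 * s"
  proof -
    define y where "y = cnj z * \<tau>"
    have "(norm (1 - cnj z * (of_real r * \<tau>)))\<^sup>2 = (norm (1 - of_real r * y))\<^sup>2"
      by (simp add: y_def algebra_simps)
    also have "\<dots> = 1 - 2 * r * Re y + r\<^sup>2 * (norm y)\<^sup>2"
      unfolding cmod_power2 by (simp add: power2_eq_square algebra_simps)
    also have "Re y = x"
      by (simp only: y_def x_def)
    also have "(norm y)\<^sup>2 = s"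
      using \<tau> by (simp add: y_def norm_mult s_def)
    finally show ?thesis .
  qed
  have nr: "(norm (of_real r * \<tau>))\<^sup>2 = r\<^sup>2"
    using \<tau> by (simp add: norm_mult)
  have r1: "1 - r \<noteq> 0" "1 + r \<noteq> 0" "1 - r\<^sup>2 \<noteq> 0"
    using r by (auto simp: power2_eq_1_iff)
  have m0: "m \<noteq> 0"
    using r1 by (simp add: m_def)
  have sq: "1 - r\<^sup>2 = (1 - r) * (1 + r)"
    by (simp add: power2_eq_square algebra_simps)
  have "(1 - 2 * r * x + r\<^sup>2 * s) / (1 - r\<^sup>2) = (1 - s) / 2 + (B\<^sup>2 * m + A\<^sup>2 / m) / 4"
    unfolding A2 B2 m_def sq using r1
    by (simp add: divide_simps) (simp add: power2_eq_square algebra_simps)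
  also have "(B\<^sup>2 * m + A\<^sup>2 / m) / 4 = A * B / 2 + (B * m - A)\<^sup>2 / (4 * m)"
    using m0 by (simp add: power2_eq_square divide_simps) (simp add: algebra_simps)
  finally show ?thesis
    by (simp add: q nr s_def)
qed

lemma geodesic_projection_eq:
  fixes z \<tau> :: complex
  assumes \<tau>: "norm \<tau> = 1" and z: "norm z < 1"
  defines "r \<equiv> (norm (z + \<tau>) - norm (z - \<tau>)) / (norm (z + \<tau>) + norm (z - \<tau>))"
  shows "geodesic_projection \<tau> z = of_real r * \<tau>"
    and "r \<in> {-1<..<1}"
    and "(1 + r) / (1 - r) = norm (z + \<tau>) / norm (z - \<tau>)"
proof -
  define A where "A = norm (z + \<tau>)"
  define B where "B = norm (z - \<tau>)"
  have A: "0 < A" and B: "0 < B"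
    using \<tau> z unfolding A_def B_def by (auto simp: add_eq_0_iff)
  have r_def': "r = (A - B) / (A + B)"
    by (simp add: r_def A_def B_def)
  show r: "r \<in> {-1<..<1}"
    using A B by (simp add: r_def' divide_simps)
  have m: "(1 + r) / (1 - r) = A / B"
  proof -
    have "1 + r = 2 * A / (A + B)" "1 - r = 2 * B / (A + B)"
      using A B by (simp_all add: r_def' divide_simps)
    then show ?thesis
      using A B by simp
  qed
  then show "(1 + r) / (1 - r) = norm (z + \<tau>) / norm (z - \<tau>)"
    by (simp add: A_def B_def)
  define w where "w = of_real r * \<tau>"
  have wG: "w \<in> diameter_geodesic \<tau>"
    using r by (auto simp: w_def diameter_geodesic_def)
  have min: "hyperbolic_dist z w < hyperbolic_dist z u" if u: "u \<in> diameter_geodesic \<tau>" "u \<noteq> w" for u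
  proof -
    obtain r' where r': "r' \<in> {-1<..<1}" "u = of_real r' * \<tau>"
      using u by (auto simp: diameter_geodesic_def)
    define m' where "m' = (1 + r') / (1 - r')"
    have m'0: "0 < m'"
      using r' by (simp add: m'_def)
    have "r' \<noteq> r"
      using u r' by (auto simp: w_def)
    then have "m' \<noteq> A / B"
      using r r' unfolding m[symmetric] m'_def by (simp add: frac_eq_eq) (simp add: algebra_simps)
    then have "B * m' - A \<noteq> 0"
      using B by (auto simp: field_simps)
    then have "0 < (B * m' - A)\<^sup>2 / (4 * m')"
      using m'0 by simp
    moreover have "(norm (1 - cnj z * w))\<^sup>2 / (1 - (norm w)\<^sup>2)
        = (1 - (norm z)\<^sup>2) / 2 + A * B / 2 + (B * (A / B) - A)\<^sup>2 / (4 * (A / B))"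
      using quotient_on_diameter[OF \<tau> r, of z, unfolded m] by (simp only: w_def A_def B_def)
    moreover have "(norm (1 - cnj z * u))\<^sup>2 / (1 - (norm u)\<^sup>2)
        = (1 - (norm z)\<^sup>2) / 2 + A * B / 2 + (B * m' - A)\<^sup>2 / (4 * m')"
      using quotient_on_diameter[OF \<tau> r'(1), of z] by (simp only: r'(2) m'_def A_def B_def)
    ultimately have "(norm (1 - cnj z * w))\<^sup>2 / (1 - (norm w)\<^sup>2) < (norm (1 - cnj z * u))\<^sup>2 / (1 - (norm u)\<^sup>2)"
      using B by simp
    moreover have "norm w < 1" "norm u < 1"
      using r r' \<tau> by (auto simp: w_def norm_mult)
    ultimately show ?thesis
      using hyperbolic_dist_less_iff_quotient z by blast
  qed
  have "geodesic_projection \<tau> z = w"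
    unfolding geodesic_projection_def
  proof (rule the_equality)
    show "w \<in> diameter_geodesic \<tau> \<and> (\<forall>u\<in>diameter_geodesic \<tau>. hyperbolic_dist z w \<le> hyperbolic_dist z u)"
      using wG min by (metis less_imp_le order_refl)
    show "v = w" if "v \<in> diameter_geodesic \<tau> \<and> (\<forall>u\<in>diameter_geodesic \<tau>. hyperbolic_dist z v \<le> hyperbolic_dist z u)" for v
      using that wG min by (meson not_less)
  qed
  then show "geodesic_projection \<tau> z = of_real r * \<tau>"
    by (simp add: w_def)
qed

lemma hyperbolic_dist_geodesic_projection:
  assumes \<tau>: "norm \<tau> = 1" and z: "norm z < 1"
  shows "hyperbolic_dist 0 (geodesic_projection \<tau> z) = \<bar>1 / 2 * ln (norm (z + \<tau>) / norm (z - \<tau>))\<bar>"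
proof -
  define r where "r = (norm (z + \<tau>) - norm (z - \<tau>)) / (norm (z + \<tau>) + norm (z - \<tau>))"
  note P = geodesic_projection_eq[OF assms, folded r_def]
  have "hyperbolic_dist 0 (geodesic_projection \<tau> z) = 1 / 2 * ln ((1 + \<bar>r\<bar>) / (1 - \<bar>r\<bar>))"
    using \<tau> by (simp add: P(1) hyperbolic_dist_0 norm_mult)
  also have "\<dots> = \<bar>1 / 2 * ln ((1 + r) / (1 - r))\<bar>"
  proof (cases "0 \<le> r")
    case True
    then have "1 \<le> (1 + r) / (1 - r)"
      using P(2) by (simp add: divide_simps)
    then have "0 \<le> ln ((1 + r) / (1 - r))"
      by (rule ln_ge_zero)
    then show ?thesis
      using True by simp
  next
    case False
    then have "(1 + r) / (1 - r) \<le> 1"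
      using P(2) by (simp add: divide_simps)
    moreover have "0 < (1 + r) / (1 - r)"
      using P(2) by simp
    ultimately have "ln ((1 + r) / (1 - r)) \<le> 0"
      using ln_le_zero_iff by blast
    moreover have "ln ((1 + \<bar>r\<bar>) / (1 - \<bar>r\<bar>)) = - ln ((1 + r) / (1 - r))"
      using False P(2) by (simp add: ln_div)
    ultimately show ?thesis by simp
  qed
  finally show ?thesis
    by (simp add: P(3))
qed

section \<open>Comparison of the two semigroups\<close>

text \<open>
  Compose \<open>\<psi>\<close> with the peak function at \<open>\<tau>\<close> of width \<open>\<bar>\<psi> 0 - \<tau>\<bar>\<close>. The result is at least \<open>1\<close> at \<open>0\<close>, hence by
  Harnack's inequality not small at \<open>b\<close>, and so \<open>\<psi> b\<close> is close to \<open>\<tau>\<close>. The constant depends on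
  \<open>b\<close> only, which makes the bound uniform over the maps of a semigroup.
\<close>

lemma distance_to_boundary_point_comparable:
  fixes \<psi> :: "complex \<Rightarrow> complex"
  assumes hol: "\<psi> holomorphic_on \<D>" and self: "\<psi> ` \<D> \<subseteq> \<D>" and \<tau>: "norm \<tau> = 1" and b: "b \<in> \<D>"
  shows "norm (\<psi> b - \<tau>) \<le> (4 * ((1 + norm b) / (1 - norm b)) + 1) * norm (\<psi> 0 - \<tau>)"
proof -
  define \<epsilon> where "\<epsilon> = norm (\<psi> 0 - \<tau>)"
  define q where "q = (1 - norm b) / (1 + norm b)"
  have \<psi>: "norm (\<psi> z) < 1" if "z \<in> \<D>" for z
    using self that by (auto simp: image_subset_iff)
  have "\<psi> 0 \<noteq> \<tau>"
    using \<psi>[of 0] \<tau> by auto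
  then have \<epsilon>: "0 < \<epsilon>"
    by (simp add: \<epsilon>_def)
  have q: "0 < q"
    using b by (auto simp: q_def intro!: divide_pos_pos add_pos_nonneg)
  define F where "F = boundary_peak \<tau> \<epsilon> \<circ> \<psi>"
  note peak = boundary_peak[OF \<tau> \<epsilon> \<psi>]
  have holF: "F holomorphic_on \<D>"
    unfolding F_def using hol holomorphic_on_boundary_peak[OF \<tau> \<epsilon>] self
    by (rule holomorphic_on_compose_gen)
  have nonneg: "0 \<le> Re (F z)" if "z \<in> \<D>" for z
    using peak(1)[OF that] by (simp add: F_def)
  have "1 \<le> Re (F 0)"
    using peak(2)[of 0] by (simp add: F_def \<epsilon>_def)
  then have "q * 1 \<le> q * Re (F 0)"
    using q by (intro mult_left_mono) auto
  also have "\<dots> \<le> Re (F b)"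
    unfolding q_def using b by (intro Harnack_disc(1)[OF holF nonneg]) auto
  finally have Fb: "q \<le> Re (F b)" by simp
  have "norm (\<psi> b - \<tau>) \<le> (4 + Re (F b)) * \<epsilon> / Re (F b)"
    using peak(4)[OF b] Fb q by (simp add: F_def pos_le_divide_eq mult.commute)
  also have "\<dots> = (4 / Re (F b) + 1) * \<epsilon>"
    using Fb q by (simp add: field_simps)
  also have "\<dots> \<le> (4 / q + 1) * \<epsilon>"
    using Fb q \<epsilon> by (intro mult_right_mono add_right_mono divide_left_mono) auto
  also have "4 / q = 4 * ((1 + norm b) / (1 - norm b))"
    by (simp add: q_def)
  finally show ?thesis
    by (simp add: \<epsilon>_def)
qed

text \<open>
  The comparison of harmonic measures: the peak function at \<open>\<tau>'\<close> pulled back by \<open>g\<close> is at least \<open>1\<close>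
  along the path \<open>x\<close> and of order \<open>\<epsilon>\<close> at \<open>0\<close>.
\<close>

lemma orbit_tail_distance_bound:
  fixes g :: "complex \<Rightarrow> complex" and x :: "real \<Rightarrow> complex"
  assumes holg: "g holomorphic_on \<D>" and self: "g ` \<D> \<subseteq> \<D>"
    and contx: "continuous_on {t..} x" and x: "\<And>s. t \<le> s \<Longrightarrow> x s \<in> \<D>"
    and lim: "(x \<longlongrightarrow> \<tau>) at_top" and \<tau>: "norm \<tau> = 1" "norm \<tau>' = 1" and \<epsilon>: "0 < \<epsilon>"
    and close: "\<And>s. t \<le> s \<Longrightarrow> norm (g (x s) - \<tau>') \<le> \<epsilon>"
  shows "norm (x t - \<tau>) \<le> 320 * pi / (1 - norm (g 0)) * \<epsilon>"
proof -
  have g: "norm (g z) < 1" if "z \<in> \<D>" for z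
    using self that by (auto simp: image_subset_iff)
  define F where "F = boundary_peak \<tau>' \<epsilon> \<circ> g"
  note peak = boundary_peak[OF \<tau>(2) \<epsilon> g]
  have holF: "F holomorphic_on \<D>"
    unfolding F_def using holg holomorphic_on_boundary_peak[OF \<tau>(2) \<epsilon>] self
    by (rule holomorphic_on_compose_gen)
  have nonneg: "0 \<le> Re (F z)" if "z \<in> \<D>" for z
    using peak(1)[OF that] by (simp add: F_def)
  have ge1: "1 \<le> Re (F (x s))" if "t \<le> s" for s
    using peak(2)[OF x[OF that] close[OF that]] by (simp add: F_def)
  have "norm (x t - \<tau>) \<le> 80 * pi * Re (F 0)"
    by (rule path_to_boundary_point_bound[OF holF nonneg contx x lim \<tau>(1) ge1])
  also have "\<dots> \<le> 80 * pi * (4 * \<epsilon> / (1 - norm (g 0)))"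
    using peak(3)[of 0] g[of 0] by (intro mult_left_mono) (auto simp: F_def pos_le_divide_eq)
  finally show ?thesis by simp
qed

lemma semigroup_orbit:
  assumes "semigroup_in_disc \<phi>" and z: "z \<in> \<D>"
  shows "\<And>t. 0 \<le> t \<Longrightarrow> \<phi> t z \<in> \<D>"
    and "continuous_on {0..} (\<lambda>t. \<phi> t z)"
proof -
  show "\<phi> t z \<in> \<D>" if "0 \<le> t" for t
  proof -
    have "\<forall>t\<ge>0. \<phi> t holomorphic_on \<D> \<and> \<phi> t ` \<D> \<subseteq> \<D>"
      using assms(1) unfolding semigroup_in_disc_def by (elim conjE)
    then show ?thesis
      using that z by (simp add: image_subset_iff)
  qed
  have "\<forall>K. compact K \<and> K \<subseteq> \<D> \<longrightarrow> (\<forall>t\<ge>0. uniform_limit K \<phi> (\<phi> t) (at t within {0..}))"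
    using assms(1) unfolding semigroup_in_disc_def by (elim conjE)
  from this[rule_format, of "{z}"]
  have "uniform_limit {z} \<phi> (\<phi> t) (at t within {0..})" if "0 \<le> t" for t
    using that z by simp
  then show "continuous_on {0..} (\<lambda>t. \<phi> t z)"
    by (simp add: continuous_on_def)
qed

lemma Koenigs_functionD:
  assumes "Koenigs_function \<phi> h"
  shows "h holomorphic_on \<D>" and "inj_on h \<D>"
    and "\<And>t z. 0 \<le> t \<Longrightarrow> z \<in> \<D> \<Longrightarrow> h (\<phi> t z) = h z + \<i> * of_real t"
proof -
  show "h holomorphic_on \<D>"
    using assms unfolding Koenigs_function_def by (elim conjE)
  show "inj_on h \<D>"
    using assms unfolding Koenigs_function_def by (elim conjE)
  have "\<forall>t\<ge>0. \<forall>z\<in>\<D>. h (\<phi> t z) = h z + \<i> * of_real t"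
    using assms unfolding Koenigs_function_def by (elim conjE)
  then show "h (\<phi> t z) = h z + \<i> * of_real t" if "0 \<le> t" "z \<in> \<D>" for t z
    using that by simp
qed

lemma Koenigs_domain_inclusion_imp_semiconjugacy:
  assumes \<phi>: "semigroup_in_disc \<phi>" and \<phi>': "semigroup_in_disc \<phi>'"
    and h: "Koenigs_function \<phi> h" and h': "Koenigs_function \<phi>' h'"
    and sub: "h ` \<D> \<subseteq> h' ` \<D>"
  obtains g where "g holomorphic_on \<D>" "g ` \<D> \<subseteq> \<D>"
    "\<And>t z. 0 \<le> t \<Longrightarrow> z \<in> \<D> \<Longrightarrow> g (\<phi> t z) = \<phi>' t (g z)"
proof -
  note K = Koenigs_functionD[OF h] and K' = Koenigs_functionD[OF h']
  obtain k where k: "k holomorphic_on h' ` \<D>" "\<And>z. z \<in> \<D> \<Longrightarrow> k (h' z) = z"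
    using holomorphic_has_inverse[OF K'(1) open_ball K'(2)] by metis
  define g where "g = (\<lambda>z. k (h z))"
  have g: "g z \<in> \<D> \<and> h' (g z) = h z" if "z \<in> \<D>" for z
  proof -
    obtain w where "w \<in> \<D>" "h z = h' w"
      using sub \<open>z \<in> \<D>\<close> by blast
    then show ?thesis
      using k(2) by (simp add: g_def)
  qed
  show ?thesis
  proof
    show "g holomorphic_on \<D>"
      unfolding g_def using holomorphic_on_compose_gen[OF K(1) k(1)] sub by (simp add: o_def image_subset_iff_funcset)
    show "g ` \<D> \<subseteq> \<D>"
      using g by blast
    show "g (\<phi> t z) = \<phi>' t (g z)" if t: "0 \<le> t" and z: "z \<in> \<D>" for t z
    proof (rule inj_onD[OF K'(2)])
      have "\<phi> t z \<in> \<D>"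
        using semigroup_orbit(1)[OF \<phi> z t] .
      then show "g (\<phi> t z) \<in> \<D>"
        using g by blast
      show "\<phi>' t (g z) \<in> \<D>"
        using semigroup_orbit(1)[OF \<phi>' _ t] g[OF z] by blast
      have "h' (g (\<phi> t z)) = h z + \<i> * of_real t"
        using g[OF \<open>\<phi> t z \<in> \<D>\<close>] K(3)[OF t z] by simp
      also have "\<dots> = h' (\<phi>' t (g z))"
        using g[OF z] K'(3)[OF t] by simp
      finally show "h' (g (\<phi> t z)) = h' (\<phi>' t (g z))" .
    qed
  qed
qed

text \<open>
  The distance bound involves the supremum of \<open>\<bar>\<phi>'\<^sub>r(0) - \<tau>'\<bar>\<close> over a whole tail \<open>r \<ge> s\<close>. It becomes a
  comparison at a single time if \<open>s\<close> is chosen so that the supremum is less than twice the value at \<open>s\<close>.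
\<close>

theorem frequently_rate_le:
  assumes \<phi>: "semigroup_in_disc \<phi>" and \<phi>': "semigroup_in_disc \<phi>'"
    and h: "Koenigs_function \<phi> h" and h': "Koenigs_function \<phi>' h'"
    and DW: "Denjoy_Wolff_point \<phi> \<tau>" and DW': "Denjoy_Wolff_point \<phi>' \<tau>'"
    and sub: "h ` \<D> \<subseteq> h' ` \<D>"
  obtains C where "0 < C" "\<exists>\<^sub>F t in at_top. norm (\<phi> t 0 - \<tau>) \<le> C * norm (\<phi>' t 0 - \<tau>')"
proof -
  obtain g where holg: "g holomorphic_on \<D>" and self: "g ` \<D> \<subseteq> \<D>"
    and conj: "\<And>t z. 0 \<le> t \<Longrightarrow> z \<in> \<D> \<Longrightarrow> g (\<phi> t z) = \<phi>' t (g z)"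
    using Koenigs_domain_inclusion_imp_semiconjugacy[OF \<phi> \<phi>' h h' sub] by blast
  define x where "x = (\<lambda>t. \<phi> t 0)"
  define \<delta> where "\<delta> = (\<lambda>t. norm (\<phi>' t 0 - \<tau>'))"
  define b where "b = g 0"
  have b: "b \<in> \<D>"
    unfolding b_def using self by (rule subsetD) simp
  have \<tau>: "norm \<tau> = 1" "norm \<tau>' = 1"
    using DW DW' by (auto simp: Denjoy_Wolff_point_def)
  have lim: "(x \<longlongrightarrow> \<tau>) at_top"
    using DW by (simp add: Denjoy_Wolff_point_def x_def)
  have x: "x t \<in> \<D>" if "0 \<le> t" for t
    unfolding x_def using semigroup_orbit(1)[OF \<phi> _ that] by simp
  have contx: "continuous_on {0..} x"
    unfolding x_def using semigroup_orbit(2)[OF \<phi>] by simp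
  have \<phi>'0: "norm (\<phi>' t 0) < 1" if "0 \<le> t" for t
    using semigroup_orbit(1)[OF \<phi>' _ that, of 0] by simp
  have \<delta>: "0 < \<delta> t" "\<delta> t \<le> 2" if "0 \<le> t" for t
    using \<phi>'0[OF that] \<tau>(2) norm_triangle_ineq4[of "\<phi>' t 0" \<tau>'] by (auto simp: \<delta>_def)
  define K where "K = 4 * ((1 + norm b) / (1 - norm b)) + 1"
  have K: "0 < K"
  proof -
    have "0 \<le> (1 + norm b) / (1 - norm b)"
      using b by simp
    then show ?thesis
      unfolding K_def by linarith
  qed
  have g_orbit: "norm (g (x t) - \<tau>') \<le> K * \<delta> t" if "0 \<le> t" for t
  proof -
    have "\<phi>' t holomorphic_on \<D>" "\<phi>' t ` \<D> \<subseteq> \<D>"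
      using \<phi>' that by (auto simp: semigroup_in_disc_def)
    then have "norm (\<phi>' t b - \<tau>') \<le> K * \<delta> t"
      unfolding K_def \<delta>_def using \<tau>(2) b by (rule distance_to_boundary_point_comparable)
    then show ?thesis
      using conj[OF that, of 0] by (simp add: x_def b_def)
  qed
  define C where "C = 320 * pi / (1 - norm b) * K * 2"
  have "0 < C"
    using K b by (simp add: C_def)
  moreover have "\<exists>\<^sub>F t in at_top. norm (\<phi> t 0 - \<tau>) \<le> C * norm (\<phi>' t 0 - \<tau>')"
    unfolding frequently_def
  proof
    assume "\<forall>\<^sub>F t in at_top. \<not> norm (\<phi> t 0 - \<tau>) \<le> C * norm (\<phi>' t 0 - \<tau>')"
    then obtain N where N: "\<And>t. N \<le> t \<Longrightarrow> \<not> norm (x t - \<tau>) \<le> C * \<delta> t"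
      by (auto simp: eventually_at_top_linorder x_def \<delta>_def)
    define t where "t = max 0 N"
    define M where "M = Sup (\<delta> ` {t..})"
    have bdd: "bdd_above (\<delta> ` {t..})"
      using \<delta>(2) by (intro bdd_aboveI[of _ 2]) (auto simp: t_def)
    have M: "\<delta> s \<le> M" if "t \<le> s" for s
      unfolding M_def using that by (intro cSup_upper bdd) auto
    have M0: "0 < M"
      using M[of t] \<delta>(1)[of t] by (simp add: t_def)
    then have "M / 2 < Sup (\<delta> ` {t..})"
      by (simp add: M_def)
    then obtain s where s: "t \<le> s" "M / 2 < \<delta> s"
      by (subst (asm) less_cSup_iff) (use bdd in auto)
    have s0: "0 \<le> s"
      using s(1) by (simp add: t_def)
    have "norm (x s - \<tau>) \<le> 320 * pi / (1 - norm (g 0)) * (K * M)"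
    proof (rule orbit_tail_distance_bound[OF holg self _ _ lim \<tau>])
      show "continuous_on {s..} x"
        using s0 by (intro continuous_on_subset[OF contx]) auto
      show "x r \<in> \<D>" if "s \<le> r" for r
        using x s0 that by simp
      show "norm (g (x r) - \<tau>') \<le> K * M" if "s \<le> r" for r
      proof -
        have "norm (g (x r) - \<tau>') \<le> K * \<delta> r"
          using g_orbit s0 that by simp
        also have "\<dots> \<le> K * M"
          using M[of r] s(1) that K by (intro mult_left_mono) auto
        finally show ?thesis .
      qed
    qed (use K M0 in simp)
    also have "\<dots> \<le> 320 * pi / (1 - norm (g 0)) * (K * (2 * \<delta> s))"
      using s(2) K b by (intro mult_left_mono) (auto simp: b_def)
    also have "\<dots> = C * \<delta> s"
      by (simp add: C_def b_def)
    finally show False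
      using N[of s] s(1) by (simp add: t_def)
  qed
  ultimately show ?thesis
    using that by blast
qed

theorem theorem1p1:
  fixes \<phi> \<phi>' :: "real \<Rightarrow> complex \<Rightarrow> complex"
    and h h' :: "complex \<Rightarrow> complex"
    and \<tau> \<tau>' :: complex
  assumes "semigroup_in_disc \<phi>" and "non_elliptic \<phi>"
    and "semigroup_in_disc \<phi>'" and "non_elliptic \<phi>'"
    and "Koenigs_function \<phi> h" and "Koenigs_function \<phi>' h'"
    and "Denjoy_Wolff_point \<phi> \<tau>" and "Denjoy_Wolff_point \<phi>' \<tau>'"
    and "h ` \<D> \<subseteq> h' ` \<D>"
  shows "Limsup at_top (\<lambda>t. ereal (orthogonal_speed \<phi> \<tau> t - orthogonal_speed \<phi>' \<tau>' t)) > -\<infinity> \<and>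
         Liminf at_top (\<lambda>t. ereal (norm (\<phi> t 0 - \<tau>) / norm (\<phi>' t 0 - \<tau>'))) < \<infinity>"
proof -
  obtain C where C: "0 < C" and freq: "\<exists>\<^sub>F t in at_top. norm (\<phi> t 0 - \<tau>) \<le> C * norm (\<phi>' t 0 - \<tau>')"
    using frequently_rate_le[OF assms(1,3,5,6,7,8,9)] .
  have \<tau>: "norm \<tau> = 1" "norm \<tau>' = 1"
    using assms(7,8) by (auto simp: Denjoy_Wolff_point_def)
  have in_disc: "norm (\<phi> t 0) < 1" "norm (\<phi>' t 0) < 1" if "0 \<le> t" for t
    using semigroup_orbit(1)[OF assms(1) _ that, of 0] semigroup_orbit(1)[OF assms(3) _ that, of 0] by auto
  have ratio: "\<exists>\<^sub>F t in at_top. norm (\<phi> t 0 - \<tau>) / norm (\<phi>' t 0 - \<tau>') \<le> C"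
  proof (rule frequently_elim1[OF freq])
    show "norm (\<phi> t 0 - \<tau>) / norm (\<phi>' t 0 - \<tau>') \<le> C"
      if "norm (\<phi> t 0 - \<tau>) \<le> C * norm (\<phi>' t 0 - \<tau>')" for t
      using that C by (cases "\<phi>' t 0 = \<tau>'") (auto simp: pos_divide_le_eq)
  qed
  have liminf: "Liminf at_top (\<lambda>t. ereal (norm (\<phi> t 0 - \<tau>) / norm (\<phi>' t 0 - \<tau>'))) \<le> ereal C"
  proof (rule ccontr)
    assume "\<not> ?thesis"
    then have "\<forall>\<^sub>F t in at_top. ereal C < ereal (norm (\<phi> t 0 - \<tau>) / norm (\<phi>' t 0 - \<tau>'))"
      by (intro less_LiminfD) auto
    then have "\<forall>\<^sub>F t in at_top. \<not> norm (\<phi> t 0 - \<tau>) / norm (\<phi>' t 0 - \<tau>') \<le> C"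
      by eventually_elim auto
    then show False
      using ratio by (simp add: frequently_def)
  qed
  have "((\<lambda>t. \<phi> t 0) \<longlongrightarrow> \<tau>) at_top" "((\<lambda>t. \<phi>' t 0) \<longlongrightarrow> \<tau>') at_top"
    using assms(7,8) by (auto simp: Denjoy_Wolff_point_def)
  from this[THEN tendstoD, of 1]
  have near: "\<forall>\<^sub>F t in at_top. norm (\<phi> t 0 - \<tau>) < 1" "\<forall>\<^sub>F t in at_top. norm (\<phi>' t 0 - \<tau>') < 1"
    by (simp_all add: dist_norm)
  \<comment> \<open>For points of the disc near \<open>\<sigma>\<close> the factor \<open>\<bar>z + \<sigma>\<bar>\<close> in the formula for the speed lies between \<open>1\<close> and \<open>2\<close>.\<close>
  have antipode: "1 \<le> norm (z + \<sigma>)" if "norm \<sigma> = 1" "norm (z - \<sigma>) < 1" for z \<sigma> :: complex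
  proof -
    have "norm (2 * \<sigma>) \<le> norm (z + \<sigma>) + norm (z - \<sigma>)"
      using norm_triangle_ineq4[of "z + \<sigma>" "z - \<sigma>"] by simp
    then show ?thesis
      using that by (simp add: norm_mult)
  qed
  define c where "c = 1 / 2 * (ln C + ln 2)"
  have speed: "\<exists>\<^sub>F t in at_top. - c \<le> orthogonal_speed \<phi> \<tau> t - orthogonal_speed \<phi>' \<tau>' t"
  proof (rule frequently_rev_mp[OF freq])
    show "\<forall>\<^sub>F t in at_top. norm (\<phi> t 0 - \<tau>) \<le> C * norm (\<phi>' t 0 - \<tau>')
            \<longrightarrow> - c \<le> orthogonal_speed \<phi> \<tau> t - orthogonal_speed \<phi>' \<tau>' t"
      using near eventually_ge_at_top[of "0::real"]
    proof eventually_elim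
      case (elim t)
      show ?case
      proof
        assume le: "norm (\<phi> t 0 - \<tau>) \<le> C * norm (\<phi>' t 0 - \<tau>')"
        define A B where "A = norm (\<phi> t 0 + \<tau>)" and "B = norm (\<phi> t 0 - \<tau>)"
        define A' B' where "A' = norm (\<phi>' t 0 + \<tau>')" and "B' = norm (\<phi>' t 0 - \<tau>')"
        have B: "0 < B" "0 < B'"
          using in_disc[OF elim(3)] \<tau> by (auto simp: B_def B'_def)
        have A: "1 \<le> A" "1 \<le> A'"
          using antipode \<tau> elim by (auto simp: A_def A'_def)
        have A2: "A' \<le> 2"
          using norm_triangle_ineq[of "\<phi>' t 0" \<tau>'] in_disc[OF elim(3)] \<tau> by (simp add: A'_def)
        have v: "orthogonal_speed \<phi> \<tau> t = \<bar>1 / 2 * ln (A / B)\<bar>"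
          unfolding orthogonal_speed_def A_def B_def
          using in_disc[OF elim(3)] \<tau> by (intro hyperbolic_dist_geodesic_projection) auto
        have v': "orthogonal_speed \<phi>' \<tau>' t = \<bar>1 / 2 * ln (A' / B')\<bar>"
          unfolding orthogonal_speed_def A'_def B'_def
          using in_disc[OF elim(3)] \<tau> by (intro hyperbolic_dist_geodesic_projection) auto
        have "1 \<le> A' / B'"
          using A elim B by (simp add: B'_def)
        then have "0 \<le> ln (A' / B')"
          by (rule ln_ge_zero)
        then have v'': "orthogonal_speed \<phi>' \<tau>' t = 1 / 2 * (ln A' - ln B')"
          using v' A B by (simp add: ln_div)
        have "ln B \<le> ln (C * B')"
          using le B C by (simp add: B_def B'_def)
        also have "\<dots> = ln C + ln B'"
          using B C by (simp add: ln_mult)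
        finally have "ln B \<le> ln C + ln B'" .
        moreover have "0 \<le> ln A"
          using A by simp
        moreover have "ln A' \<le> ln 2"
          using A A2 by simp
        moreover have "1 / 2 * (ln A - ln B) \<le> orthogonal_speed \<phi> \<tau> t"
          using v A B by (simp add: ln_div)
        ultimately show "- c \<le> orthogonal_speed \<phi> \<tau> t - orthogonal_speed \<phi>' \<tau>' t"
          unfolding v'' c_def by (simp add: field_simps)
      qed
    qed
  qed
  have limsup: "ereal (- c) \<le> Limsup at_top (\<lambda>t. ereal (orthogonal_speed \<phi> \<tau> t - orthogonal_speed \<phi>' \<tau>' t))"
  proof (rule ccontr)
    assume "\<not> ?thesis"
    then have "\<forall>\<^sub>F t in at_top. ereal (orthogonal_speed \<phi> \<tau> t - orthogonal_speed \<phi>' \<tau>' t) < ereal (- c)"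
      by (intro Limsup_lessD) auto
    then have "\<forall>\<^sub>F t in at_top. \<not> - c \<le> orthogonal_speed \<phi> \<tau> t - orthogonal_speed \<phi>' \<tau>' t"
      by eventually_elim auto
    then show False
      using speed by (simp add: frequently_def)
  qed
  show ?thesis
    using liminf limsup by (auto intro: le_less_trans less_le_trans)
qed

end
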